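(* Let $G:\mathbb{B}\to\mathbb{C}$ be a functor that has a left adjoint. If there is a pseudofunctor $(\mathcal{A},\mathfrak{a}):\Delta_3\to\mathrm{Cat}$ such that $G=\mathsf{d}^{\mathcal{A}}\circ\mathcal{K}$ for some equivalence of categories $\mathcal{K}:\mathbb{B}\to\mathrm{lax}\text{-}\mathrm{Desc}(\mathcal{A})$, where $\mathsf{d}^{\mathcal{A}}:\mathrm{lax}\text{-}\mathrm{Desc}(\mathcal{A})\to\mathcal{A}(\mathsf{1})$ is the forgetful functor of the lax descent category of $\mathcal{A}$, then $G$ is monadic.
   Context: $\mathrm{Cat}$ is the $2$-category of categories in some universe. A right adjoint functor is monadic if its comparison functor to the Eilenberg-Moore category of the induced monad is an equivalence of categories. The category $\Delta_3$: the subcategory of the category of finite nonempty ordinals and order-preserving maps with objects $\mathsf{1},\mathsf{2},\mathsf{3}$ generated by the maps $d^0,d^1:\mathsf{1}\to\mathsf{2}$, $s^0:\mathsf{2}\to\mathsf{1}$, $D^0,D^1,D^2:\mathsf{2}\to\mathsf{3}$ (the usual cofaces, $d^i$ and $D^i$ omitting $i$ from the image, and codegeneracy), subject to $s^0d^1=\mathrm{id}_{\mathsf{1}}=s^0d^0$ and $D^td^k=D^kd^{t-1}$ for $t>k$. A pseudofunctor $(\mathcal{A},\mathfrak{a}):\Delta_3\to\mathrm{Cat}$ has invertible natural transformations $\mathfrak{a}_{hg}:\mathcal{A}(h)\mathcal{A}(g)\Rightarrow\mathcal{A}(hg)$ and $\mathfrak{a}_x:\mathrm{id}_{\mathcal{A}(x)}\Rightarrow\mathcal{A}(\mathrm{id}_x)$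 satisfying the usual coherence equations. Put $\mathcal{A}(\sigma_{01})=\mathfrak{a}_{D^0d^0}^{-1}\cdot\mathfrak{a}_{D^1d^0}$, $\mathcal{A}(\sigma_{02})=\mathfrak{a}_{D^0d^1}^{-1}\cdot\mathfrak{a}_{D^2d^0}$, $\mathcal{A}(\sigma_{12})=\mathfrak{a}_{D^1d^1}^{-1}\cdot\mathfrak{a}_{D^2d^1}$, $\mathcal{A}(\mathfrak{n}_0)=\mathfrak{a}_{\mathsf{1}}^{-1}\cdot\mathfrak{a}_{s^0d^0}$, $\mathcal{A}(\mathfrak{n}_1)=\mathfrak{a}_{\mathsf{1}}^{-1}\cdot\mathfrak{a}_{s^0d^1}$. Lax descent category $\mathrm{lax}\text{-}\mathrm{Desc}(\mathcal{A})$: objects are pairs $(w,\varphi)$ with $w$ an object of $\mathcal{A}(\mathsf{1})$ and $\varphi:\mathcal{A}(d^1)(w)\to\mathcal{A}(d^0)(w)$ a morphism of $\mathcal{A}(\mathsf{2})$ such that $\mathcal{A}(D^0)(\varphi)\cdot\mathcal{A}(\sigma_{02})_w\cdot\mathcal{A}(D^2)(\varphi)=\mathcal{A}(\sigma_{01})_w\cdot\mathcal{A}(D^1)(\varphi)\cdot\mathcal{A}(\sigma_{12})_w$ and $\mathcal{A}(\mathfrak{n}_0)_w\cdot\mathcal{A}(s^0)(\varphi)=\mathcal{A}(\mathfrak{n}_1)_w$. A morphism $(w,\varphi)\to(w',\varphi')$ is a morphism $m:w\to w'$ of $\mathcal{A}(\mathsf{1})$ with $\mathcal{A}(d^0)(m)\cdot\varphi=\varphi'\cdot\mathcal{A}(d^1)(m)$;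 composition is that of $\mathcal{A}(\mathsf{1})$. The forgetful functor $\mathsf{d}^{\mathcal{A}}$ sends $(w,\varphi)\mapsto w$ and $m\mapsto m$. *)

theory Defs
  imports Main
begin

section \<open>Categories, functors and natural transformations\<close>

text \<open>A category is carried by a set of objects and a set of arrows; the values of the structure
  maps outside the carriers are irrelevant.  The pair of types \<open>'o\<close>, \<open>'m\<close> plays the role of the
  universe in which the objects and the arrows of the categories live.\<close>

record ('o, 'm) category =
  Obj :: "'o set"
  Arr :: "'m set"
  Dom :: "'m \<Rightarrow> 'o"
  Cod :: "'m \<Rightarrow> 'o"
  Idt :: "'o \<Rightarrow> 'm"
  Comp :: "'m \<Rightarrow> 'm \<Rightarrow> 'm"  (infixl \<open>\<cdot>\<index>\<close> 70)

definition hom :: "('o, 'm, 'x) category_scheme \<Rightarrow> 'o \<Rightarrow> 'o \<Rightarrow> 'm set" where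
  "hom C x y = {f \<in> Arr C. Dom C f = x \<and> Cod C f = y}"

locale category =
  fixes C :: "('o, 'm) category" (structure)
  assumes Dom_in_Obj: "f \<in> Arr C \<Longrightarrow> Dom C f \<in> Obj C"
    and Cod_in_Obj: "f \<in> Arr C \<Longrightarrow> Cod C f \<in> Obj C"
    and Idt_in_hom: "x \<in> Obj C \<Longrightarrow> Idt C x \<in> hom C x x"
    and Comp_in_hom: "\<lbrakk>f \<in> hom C x y; g \<in> hom C y z\<rbrakk> \<Longrightarrow> g \<cdot> f \<in> hom C x z"
    and Comp_Idt_left: "f \<in> hom C x y \<Longrightarrow> Idt C y \<cdot> f = f"
    and Comp_Idt_right: "f \<in> hom C x y \<Longrightarrow> f \<cdot> Idt C x = f"
    and Comp_assoc:
      "\<lbrakk>f \<in> hom C w x; g \<in> hom C x y; h \<in> hom C y z\<rbrakk> \<Longrightarrow> (h \<cdot> g) \<cdot> f = h \<cdot> (g \<cdot> f)"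

definition inverse_arrows :: "('o, 'm) category \<Rightarrow> 'm \<Rightarrow> 'm \<Rightarrow> bool" where
  "inverse_arrows C f g \<longleftrightarrow>
     f \<in> Arr C \<and> g \<in> hom C (Cod C f) (Dom C f) \<and>
     g \<cdot>\<^bsub>C\<^esub> f = Idt C (Dom C f) \<and> f \<cdot>\<^bsub>C\<^esub> g = Idt C (Cod C f)"

definition iso :: "('o, 'm) category \<Rightarrow> 'm \<Rightarrow> bool" where
  "iso C f \<longleftrightarrow> (\<exists>g. inverse_arrows C f g)"

definition inverse_of :: "('o, 'm) category \<Rightarrow> 'm \<Rightarrow> 'm" where
  "inverse_of C f = (THE g. inverse_arrows C f g)"

record ('o1, 'm1, 'o2, 'm2) fctr =
  FOb :: "'o1 \<Rightarrow> 'o2"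
  FAr :: "'m1 \<Rightarrow> 'm2"

locale is_functor = dom: category B + cod: category C
  for B :: "('o1, 'm1) category" and C :: "('o2, 'm2) category" +
  fixes F :: "('o1, 'm1, 'o2, 'm2) fctr"
  assumes FOb_in_Obj: "x \<in> Obj B \<Longrightarrow> FOb F x \<in> Obj C"
    and FAr_in_hom: "f \<in> hom B x y \<Longrightarrow> FAr F f \<in> hom C (FOb F x) (FOb F y)"
    and FAr_Idt: "x \<in> Obj B \<Longrightarrow> FAr F (Idt B x) = Idt C (FOb F x)"
    and FAr_Comp:
      "\<lbrakk>f \<in> hom B x y; g \<in> hom B y z\<rbrakk> \<Longrightarrow> FAr F (g \<cdot>\<^bsub>B\<^esub> f) = FAr F g \<cdot>\<^bsub>C\<^esub> FAr F f"

definition functor_eq ::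
  "('o1, 'm1) category \<Rightarrow> ('o1, 'm1, 'o2, 'm2) fctr \<Rightarrow> ('o1, 'm1, 'o2, 'm2) fctr \<Rightarrow> bool" where
  "functor_eq B F G \<longleftrightarrow>
     (\<forall>x \<in> Obj B. FOb F x = FOb G x) \<and> (\<forall>f \<in> Arr B. FAr F f = FAr G f)"

definition id_functor :: "('o, 'm, 'o, 'm) fctr" where
  "id_functor = \<lparr>FOb = (\<lambda>x. x), FAr = (\<lambda>f. f)\<rparr>"

definition functor_comp ::
  "('o2, 'm2, 'o3, 'm3) fctr \<Rightarrow> ('o1, 'm1, 'o2, 'm2) fctr \<Rightarrow> ('o1, 'm1, 'o3, 'm3) fctr"
  (infixl \<open>\<circ>\<^sub>F\<close> 75) where
  "G \<circ>\<^sub>F F = \<lparr>FOb = (\<lambda>x. FOb G (FOb F x)), FAr = (\<lambda>f. FAr G (FAr F f))\<rparr>"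

locale nat_transf = F: is_functor B C F + G: is_functor B C G
  for B :: "('o1, 'm1) category" and C :: "('o2, 'm2) category"
    and F G :: "('o1, 'm1, 'o2, 'm2) fctr" +
  fixes \<tau> :: "'o1 \<Rightarrow> 'm2"
  assumes component_in_hom: "x \<in> Obj B \<Longrightarrow> \<tau> x \<in> hom C (FOb F x) (FOb G x)"
    and naturality: "f \<in> hom B x y \<Longrightarrow> \<tau> y \<cdot>\<^bsub>C\<^esub> FAr F f = FAr G f \<cdot>\<^bsub>C\<^esub> \<tau> x"

locale nat_iso = nat_transf +
  assumes component_iso: "x \<in> Obj B \<Longrightarrow> iso C (\<tau> x)"

definition equivalence ::
  "('o1, 'm1) category \<Rightarrow> ('o2, 'm2) category \<Rightarrow> ('o1, 'm1, 'o2, 'm2) fctr \<Rightarrow> bool" where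
  "equivalence B C K \<longleftrightarrow>
     is_functor B C K \<and>
     (\<exists>L \<alpha> \<beta>. is_functor C B L \<and>
        nat_iso B B id_functor (L \<circ>\<^sub>F K) \<alpha> \<and> nat_iso C C (K \<circ>\<^sub>F L) id_functor \<beta>)"


section \<open>Adjunctions and monadic functors\<close>

locale adjunction = F: is_functor C B F + G: is_functor B C G
  + unit: nat_transf C C id_functor "G \<circ>\<^sub>F F" \<eta>
  + counit: nat_transf B B "F \<circ>\<^sub>F G" id_functor \<epsilon>
  for B :: "('ob, 'mb) category" and C :: "('oc, 'mc) category"
    and F :: "('oc, 'mc, 'ob, 'mb) fctr" and G :: "('ob, 'mb, 'oc, 'mc) fctr"
    and \<eta> :: "'oc \<Rightarrow> 'mc" and \<epsilon> :: "'ob \<Rightarrow> 'mb" +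
  assumes triangle_F: "c \<in> Obj C \<Longrightarrow> \<epsilon> (FOb F c) \<cdot>\<^bsub>B\<^esub> FAr F (\<eta> c) = Idt B (FOb F c)"
    and triangle_G: "b \<in> Obj B \<Longrightarrow> FAr G (\<epsilon> b) \<cdot>\<^bsub>C\<^esub> \<eta> (FOb G b) = Idt C (FOb G b)"

definition has_left_adjoint ::
  "('ob, 'mb) category \<Rightarrow> ('oc, 'mc) category \<Rightarrow> ('ob, 'mb, 'oc, 'mc) fctr \<Rightarrow> bool" where
  "has_left_adjoint B C G \<longleftrightarrow> (\<exists>F \<eta> \<epsilon>. adjunction B C F G \<eta> \<epsilon>)"

text \<open>Arrows of a category whose objects are objects of \<open>C\<close> with extra structure are triples
  (domain, underlying arrow of \<open>C\<close>, codomain), so that hom-sets are disjoint.\<close>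

definition structured_category ::
  "('o, 'm) category \<Rightarrow> ('o \<times> 's) set \<Rightarrow> ('o \<times> 's \<Rightarrow> 'm \<Rightarrow> 'o \<times> 's \<Rightarrow> bool)
    \<Rightarrow> ('o \<times> 's, ('o \<times> 's) \<times> 'm \<times> ('o \<times> 's)) category" where
  "structured_category C X P =
     \<lparr>Obj = X,
      Arr = {(p, m, q). p \<in> X \<and> q \<in> X \<and> m \<in> hom C (fst p) (fst q) \<and> P p m q},
      Dom = (\<lambda>(p, m, q). p),
      Cod = (\<lambda>(p, m, q). q),
      Idt = (\<lambda>p. (p, Idt C (fst p), p)),
      Comp = (\<lambda>(p', n, q') (p, m, q). (p, n \<cdot>\<^bsub>C\<^esub> m, q'))\<rparr>"

text \<open>The Eilenberg-Moore category of a monad \<open>(T, \<eta>, \<mu>)\<close> on \<open>C\<close>.\<close>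

definition EM_algebras ::
  "('o, 'm) category \<Rightarrow> ('o, 'm, 'o, 'm) fctr \<Rightarrow> ('o \<Rightarrow> 'm) \<Rightarrow> ('o \<Rightarrow> 'm) \<Rightarrow> ('o \<times> 'm) set" where
  "EM_algebras C T \<eta> \<mu> =
     {(x, a). x \<in> Obj C \<and> a \<in> hom C (FOb T x) x \<and>
        a \<cdot>\<^bsub>C\<^esub> \<eta> x = Idt C x \<and> a \<cdot>\<^bsub>C\<^esub> FAr T a = a \<cdot>\<^bsub>C\<^esub> \<mu> x}"

definition EM_category ::
  "('o, 'm) category \<Rightarrow> ('o, 'm, 'o, 'm) fctr \<Rightarrow> ('o \<Rightarrow> 'm) \<Rightarrow> ('o \<Rightarrow> 'm)
    \<Rightarrow> ('o \<times> 'm, ('o \<times> 'm) \<times> 'm \<times> ('o \<times> 'm)) category" where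
  "EM_category C T \<eta> \<mu> =
     structured_category C (EM_algebras C T \<eta> \<mu>)
       (\<lambda>(x, a) m (y, b). m \<cdot>\<^bsub>C\<^esub> a = b \<cdot>\<^bsub>C\<^esub> FAr T m)"

definition induced_mult ::
  "('oc, 'mc, 'ob, 'mb) fctr \<Rightarrow> ('ob, 'mb, 'oc, 'mc) fctr \<Rightarrow> ('ob \<Rightarrow> 'mb) \<Rightarrow> 'oc \<Rightarrow> 'mc" where
  "induced_mult F G \<epsilon> = (\<lambda>c. FAr G (\<epsilon> (FOb F c)))"

abbreviation EM_of_adjunction ::
  "('oc, 'mc) category \<Rightarrow> ('oc, 'mc, 'ob, 'mb) fctr \<Rightarrow> ('ob, 'mb, 'oc, 'mc) fctr
    \<Rightarrow> ('oc \<Rightarrow> 'mc) \<Rightarrow> ('ob \<Rightarrow> 'mb) \<Rightarrow> ('oc \<times> 'mc, ('oc \<times> 'mc) \<times> 'mc \<times> ('oc \<times> 'mc)) category" where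
  "EM_of_adjunction C F G \<eta> \<epsilon> \<equiv> EM_category C (G \<circ>\<^sub>F F) \<eta> (induced_mult F G \<epsilon>)"

definition comparison_functor ::
  "('ob, 'mb) category \<Rightarrow> ('ob, 'mb, 'oc, 'mc) fctr \<Rightarrow> ('ob \<Rightarrow> 'mb)
    \<Rightarrow> ('ob, 'mb, 'oc \<times> 'mc, ('oc \<times> 'mc) \<times> 'mc \<times> ('oc \<times> 'mc)) fctr" where
  "comparison_functor B G \<epsilon> =
     (let alg = (\<lambda>b. (FOb G b, FAr G (\<epsilon> b)))
      in \<lparr>FOb = alg, FAr = (\<lambda>f. (alg (Dom B f), FAr G f, alg (Cod B f)))\<rparr>)"

text \<open>Left adjoints are unique only up to isomorphism; the comparison functor is required to be an
  equivalence for every choice of left adjoint, unit and counit.\<close>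

definition monadic ::
  "('ob, 'mb) category \<Rightarrow> ('oc, 'mc) category \<Rightarrow> ('ob, 'mb, 'oc, 'mc) fctr \<Rightarrow> bool" where
  "monadic B C G \<longleftrightarrow>
     has_left_adjoint B C G \<and>
     (\<forall>F \<eta> \<epsilon>. adjunction B C F G \<eta> \<epsilon> \<longrightarrow>
        equivalence B (EM_of_adjunction C F G \<eta> \<epsilon>) (comparison_functor B G \<epsilon>))"


section \<open>The category \<open>\<Delta>\<^sub>3\<close>\<close>

text \<open>The ordinal \<open>n\<close> is \<open>{0, \<dots>, n - 1}\<close>.  A map \<open>m \<rightarrow> n\<close> is the pair \<open>(xs, n)\<close> with \<open>xs\<close> the list
  of its \<open>m\<close> values.\<close>

type_synonym ordmap = "nat list \<times> nat"

definition ord_cat :: "(nat, ordmap) category" where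
  "ord_cat =
     \<lparr>Obj = {n. 0 < n},
      Arr = {(xs, n). xs \<noteq> [] \<and> sorted xs \<and> set xs \<subseteq> {..<n}},
      Dom = (\<lambda>(xs, n). length xs),
      Cod = (\<lambda>(xs, n). n),
      Idt = (\<lambda>n. ([0..<n], n)),
      Comp = (\<lambda>(ys, k) (xs, n). (map (\<lambda>i. ys ! i) xs, k))\<rparr>"

text \<open>The coface \<open>n \<rightarrow> n + 1\<close> omitting \<open>i\<close>.\<close>

definition coface :: "nat \<Rightarrow> nat \<Rightarrow> ordmap" where
  "coface n i = (filter (\<lambda>k. k \<noteq> i) [0..<n + 1], n + 1)"

abbreviation d_face :: "nat \<Rightarrow> ordmap" (\<open>\<d>\<close>) where "\<d> i \<equiv> coface 1 i"
abbreviation D_face :: "nat \<Rightarrow> ordmap" (\<open>\<DD>\<close>) where "\<DD> i \<equiv> coface 2 i"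
definition s_degen :: ordmap (\<open>\<s>\<^sub>0\<close>) where "\<s>\<^sub>0 = ([0, 0], 1)"

inductive_set Delta3_arrows :: "ordmap set" where
  ident: "n \<in> {1, 2, 3} \<Longrightarrow> Idt ord_cat n \<in> Delta3_arrows"
| d: "i \<in> {0, 1} \<Longrightarrow> \<d> i \<in> Delta3_arrows"
| s: "\<s>\<^sub>0 \<in> Delta3_arrows"
| D: "i \<in> {0, 1, 2} \<Longrightarrow> \<DD> i \<in> Delta3_arrows"
| comp: "\<lbrakk>f \<in> Delta3_arrows; g \<in> Delta3_arrows; Dom ord_cat g = Cod ord_cat f\<rbrakk>
    \<Longrightarrow> g \<cdot>\<^bsub>ord_cat\<^esub> f \<in> Delta3_arrows"

definition Delta3 :: "(nat, ordmap) category" where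
  "Delta3 = ord_cat\<lparr>Obj := {1, 2, 3}, Arr := Delta3_arrows\<rparr>"

lemma Delta3_relations:
  "\<s>\<^sub>0 \<cdot>\<^bsub>Delta3\<^esub> \<d> 0 = Idt Delta3 1"
  "\<s>\<^sub>0 \<cdot>\<^bsub>Delta3\<^esub> \<d> 1 = Idt Delta3 1"
  "\<DD> 1 \<cdot>\<^bsub>Delta3\<^esub> \<d> 0 = \<DD> 0 \<cdot>\<^bsub>Delta3\<^esub> \<d> 0"
  "\<DD> 2 \<cdot>\<^bsub>Delta3\<^esub> \<d> 0 = \<DD> 0 \<cdot>\<^bsub>Delta3\<^esub> \<d> 1"
  "\<DD> 2 \<cdot>\<^bsub>Delta3\<^esub> \<d> 1 = \<DD> 1 \<cdot>\<^bsub>Delta3\<^esub> \<d> 1"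
  by (simp_all add: Delta3_def ord_cat_def coface_def s_degen_def upt_rec numeral_eq_Suc)


section \<open>Pseudofunctors and the lax descent category\<close>

text \<open>\<open>PComp \<A> h g\<close> is \<open>\<aa>\<^bsub>hg\<^esub> : \<A>(h)\<A>(g) \<Rightarrow> \<A>(hg)\<close> and \<open>PUnit \<A> x\<close> is
  \<open>\<aa>\<^bsub>x\<^esub> : id \<Rightarrow> \<A>(id\<^sub>x)\<close>.\<close>

record ('i, 'j, 'o, 'm) pseudo_data =
  PObj :: "'i \<Rightarrow> ('o, 'm) category"
  PArr :: "'j \<Rightarrow> ('o, 'm, 'o, 'm) fctr"
  PComp :: "'j \<Rightarrow> 'j \<Rightarrow> 'o \<Rightarrow> 'm"
  PUnit :: "'i \<Rightarrow> 'o \<Rightarrow> 'm"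

locale pseudofunctor = S: category S
  for S :: "('i, 'j) category" +
  fixes \<A> :: "('i, 'j, 'o, 'm) pseudo_data"
  assumes PObj_category: "x \<in> Obj S \<Longrightarrow> category (PObj \<A> x)"
    and PArr_functor: "f \<in> hom S x y \<Longrightarrow> is_functor (PObj \<A> x) (PObj \<A> y) (PArr \<A> f)"
    and PComp_nat_iso: "\<lbrakk>g \<in> hom S x y; h \<in> hom S y z\<rbrakk> \<Longrightarrow>
      nat_iso (PObj \<A> x) (PObj \<A> z)
        (PArr \<A> h \<circ>\<^sub>F PArr \<A> g) (PArr \<A> (h \<cdot>\<^bsub>S\<^esub> g)) (PComp \<A> h g)"
    and PUnit_nat_iso: "x \<in> Obj S \<Longrightarrow>
      nat_iso (PObj \<A> x) (PObj \<A> x) id_functor (PArr \<A> (Idt S x)) (PUnit \<A> x)"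
    and assoc_coherence:
      "\<lbrakk>f \<in> hom S w x; g \<in> hom S x y; h \<in> hom S y z; c \<in> Obj (PObj \<A> w)\<rbrakk> \<Longrightarrow>
       PComp \<A> h (g \<cdot>\<^bsub>S\<^esub> f) c \<cdot>\<^bsub>PObj \<A> z\<^esub> FAr (PArr \<A> h) (PComp \<A> g f c)
       = PComp \<A> (h \<cdot>\<^bsub>S\<^esub> g) f c \<cdot>\<^bsub>PObj \<A> z\<^esub> PComp \<A> h g (FOb (PArr \<A> f) c)"
    and left_unit_coherence:
      "\<lbrakk>f \<in> hom S x y; c \<in> Obj (PObj \<A> x)\<rbrakk> \<Longrightarrow>
       PComp \<A> (Idt S y) f c \<cdot>\<^bsub>PObj \<A> y\<^esub> PUnit \<A> y (FOb (PArr \<A> f) c)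
       = Idt (PObj \<A> y) (FOb (PArr \<A> f) c)"
    and right_unit_coherence:
      "\<lbrakk>f \<in> hom S x y; c \<in> Obj (PObj \<A> x)\<rbrakk> \<Longrightarrow>
       PComp \<A> f (Idt S x) c \<cdot>\<^bsub>PObj \<A> y\<^esub> FAr (PArr \<A> f) (PUnit \<A> x c)
       = Idt (PObj \<A> y) (FOb (PArr \<A> f) c)"

definition sigma01 :: "(nat, ordmap, 'o, 'm) pseudo_data \<Rightarrow> 'o \<Rightarrow> 'm" where
  "sigma01 \<A> w =
     inverse_of (PObj \<A> 3) (PComp \<A> (\<DD> 0) (\<d> 0) w) \<cdot>\<^bsub>PObj \<A> 3\<^esub> PComp \<A> (\<DD> 1) (\<d> 0) w"

definition sigma02 :: "(nat, ordmap, 'o, 'm) pseudo_data \<Rightarrow> 'o \<Rightarrow> 'm" where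
  "sigma02 \<A> w =
     inverse_of (PObj \<A> 3) (PComp \<A> (\<DD> 0) (\<d> 1) w) \<cdot>\<^bsub>PObj \<A> 3\<^esub> PComp \<A> (\<DD> 2) (\<d> 0) w"

definition sigma12 :: "(nat, ordmap, 'o, 'm) pseudo_data \<Rightarrow> 'o \<Rightarrow> 'm" where
  "sigma12 \<A> w =
     inverse_of (PObj \<A> 3) (PComp \<A> (\<DD> 1) (\<d> 1) w) \<cdot>\<^bsub>PObj \<A> 3\<^esub> PComp \<A> (\<DD> 2) (\<d> 1) w"

definition nn :: "(nat, ordmap, 'o, 'm) pseudo_data \<Rightarrow> nat \<Rightarrow> 'o \<Rightarrow> 'm" where
  "nn \<A> i w = inverse_of (PObj \<A> 1) (PUnit \<A> 1 w) \<cdot>\<^bsub>PObj \<A> 1\<^esub> PComp \<A> \<s>\<^sub>0 (\<d> i) w"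

definition lax_descent_data :: "(nat, ordmap, 'o, 'm) pseudo_data \<Rightarrow> ('o \<times> 'm) set" where
  "lax_descent_data \<A> =
     {(w, \<phi>). w \<in> Obj (PObj \<A> 1) \<and>
        \<phi> \<in> hom (PObj \<A> 2) (FOb (PArr \<A> (\<d> 1)) w) (FOb (PArr \<A> (\<d> 0)) w) \<and>
        FAr (PArr \<A> (\<DD> 0)) \<phi> \<cdot>\<^bsub>PObj \<A> 3\<^esub> sigma02 \<A> w \<cdot>\<^bsub>PObj \<A> 3\<^esub> FAr (PArr \<A> (\<DD> 2)) \<phi>
        = sigma01 \<A> w \<cdot>\<^bsub>PObj \<A> 3\<^esub> FAr (PArr \<A> (\<DD> 1)) \<phi> \<cdot>\<^bsub>PObj \<A> 3\<^esub> sigma12 \<A> w \<and>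
        nn \<A> 0 w \<cdot>\<^bsub>PObj \<A> 1\<^esub> FAr (PArr \<A> \<s>\<^sub>0) \<phi> = nn \<A> 1 w}"

definition lax_Desc ::
  "(nat, ordmap, 'o, 'm) pseudo_data \<Rightarrow> ('o \<times> 'm, ('o \<times> 'm) \<times> 'm \<times> ('o \<times> 'm)) category" where
  "lax_Desc \<A> =
     structured_category (PObj \<A> 1) (lax_descent_data \<A>)
       (\<lambda>(w, \<phi>) m (w', \<phi>').
          FAr (PArr \<A> (\<d> 0)) m \<cdot>\<^bsub>PObj \<A> 2\<^esub> \<phi> = \<phi>' \<cdot>\<^bsub>PObj \<A> 2\<^esub> FAr (PArr \<A> (\<d> 1)) m)"

definition lax_Desc_forget :: "('o \<times> 'm, ('o \<times> 'm) \<times> 'm \<times> ('o \<times> 'm), 'o, 'm) fctr" where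
  "lax_Desc_forget = \<lparr>FOb = fst, FAr = (\<lambda>(p, m, q). m)\<rparr>"

end

theory Submission
  imports Defs
begin

text \<open>Let \<open>F\<close> be left adjoint to \<open>G\<close>, and let \<open>\<phi>\<^sub>b\<close> be the descent datum that \<open>\<K>\<close> puts on \<open>G b\<close>.
  Because \<open>\<K>\<close> is an equivalence over the base \<open>\<A>(1)\<close>, the arrows \<open>b \<rightarrow> b'\<close> are the arrows
  \<open>m : G b \<rightarrow> G b'\<close> compatible with \<open>\<phi>\<^sub>b\<close> and \<open>\<phi>\<^sub>b\<^sub>'\<close>, and every descent datum is isomorphic to some
  \<open>\<phi>\<^sub>b\<close>.  It has to be shown that algebra structures carry the same information.

  What makes this work is that split epimorphisms, unlike general ones, are preserved by all the
  functors \<open>\<A>(f)\<close>.  All the compatibility conditions are commuting squares, and a square can be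
  cancelled along a split epimorphism.  This has two consequences for an arrow \<open>e\<close> of \<open>\<A>(1)\<close> that is
  a split epimorphism there and compatible with data on its domain and codomain.  If a composite
  \<open>m \<cdot> e\<close> is compatible with the data, then so is \<open>m\<close> (\<open>square_descends\<close>).  And if only the domain
  is known to satisfy the descent equations, then the codomain satisfies them too
  (\<open>descent_datum_descends\<close>): each side of an equation for the codomain forms a commuting square
  with the same side of the equation for the domain and the same two images of \<open>e\<close>, and one of these
  images can be cancelled.

  The structure map of an algebra \<open>(x, a)\<close> is split by the unit, so this applies with \<open>e = a\<close>.

  Fully faithful: for an algebra homomorphism \<open>m : G b \<rightarrow> G b'\<close> the composite \<open>m \<cdot> G \<epsilon>\<^sub>b\<close> equals
  \<open>G (\<epsilon>\<^sub>b\<^sub>' \<cdot> F m)\<close>, which is compatible because it comes from \<open>B\<close>; hence \<open>m\<close> is compatible and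
  comes from \<open>B\<close> (\<open>algebra_hom_lifts\<close>).

  Essentially surjective: an algebra \<open>a : G F x \<rightarrow> x\<close> is the split coequalizer of \<open>G F a\<close> and
  \<open>G \<epsilon>\<^sub>F\<^sub>x\<close>, both of which come from \<open>B\<close>.  So the datum \<open>\<phi>\<^sub>F\<^sub>x\<close> induces a candidate on \<open>x\<close>
  (\<open>split_fork_structure\<close>), which is a descent datum by the above (\<open>algebra_datum\<close>).  It is isomorphic
  to some \<open>\<phi>\<^sub>b\<close>, and a triangle identity shows that this isomorphism is one of algebras
  (\<open>algebra_from_object\<close>).\<close>


section \<open>Calculus of arrows\<close>

lemma hom_iff: "f \<in> hom C x y \<longleftrightarrow> f \<in> Arr C \<and> Dom C f = x \<and> Cod C f = y"
  by (simp add: hom_def)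

context category
begin

lemma Idt_arr:
  assumes "x \<in> Obj C"
  shows "Idt C x \<in> Arr C" "Dom C (Idt C x) = x" "Cod C (Idt C x) = x"
  using Idt_in_hom[OF assms] by (auto simp: hom_iff)

lemma Comp_arr:
  assumes "f \<in> Arr C" "g \<in> Arr C" "Cod C f = Dom C g"
  shows "g \<cdot> f \<in> Arr C" "Dom C (g \<cdot> f) = Dom C f" "Cod C (g \<cdot> f) = Cod C g"
  using Comp_in_hom[of f "Dom C f" "Cod C f" g "Cod C g"] assms by (auto simp: hom_iff)

lemma Comp_Idt:
  assumes "f \<in> Arr C"
  shows "Cod C f = y \<Longrightarrow> Idt C y \<cdot> f = f" "Dom C f = x \<Longrightarrow> f \<cdot> Idt C x = f"
  using Comp_Idt_left[of f x y] Comp_Idt_right[of f x y] assms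
  by (metis hom_iff Comp_Idt_left Comp_Idt_right)+

lemma Comp_assoc_arr:
  assumes "f \<in> Arr C" "g \<in> Arr C" "h \<in> Arr C" "Cod C f = Dom C g" "Cod C g = Dom C h"
  shows "(h \<cdot> g) \<cdot> f = h \<cdot> (g \<cdot> f)"
  using Comp_assoc[of f "Dom C f" "Cod C f" g "Cod C g" h "Cod C h"] assms by (auto simp: hom_iff)

lemmas arr_simps = Idt_arr Comp_arr Comp_Idt Comp_assoc_arr Dom_in_Obj Cod_in_Obj hom_iff

lemma hom_Obj:
  assumes "f \<in> hom C x y"
  shows "x \<in> Obj C" "y \<in> Obj C"
  using assms Dom_in_Obj Cod_in_Obj by (auto simp: hom_iff)

lemma split_epi_cancel:
  assumes "e \<cdot> s = Idt C y" "e \<in> hom C x y" "s \<in> hom C y x"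
    and "f \<in> hom C y z" "g \<in> hom C y z" "f \<cdot> e = g \<cdot> e"
  shows "f = g"
proof -
  have "f = (f \<cdot> e) \<cdot> s" "(g \<cdot> e) \<cdot> s = g"
    using assms(1-5) by (simp_all add: Comp_assoc_arr Comp_Idt hom_iff)
  then show ?thesis
    using assms(6) by simp
qed

lemma inverse_arrows_hom:
  assumes "f \<in> hom C x y"
  shows "inverse_arrows C f g \<longleftrightarrow> g \<in> hom C y x \<and> g \<cdot> f = Idt C x \<and> f \<cdot> g = Idt C y"
  using assms by (auto simp: inverse_arrows_def hom_iff)

lemma inverse_of_props:
  assumes "iso C f" "f \<in> hom C x y"
  shows "inverse_of C f \<in> hom C y x"
    and "inverse_of C f \<cdot> f = Idt C x" and "f \<cdot> inverse_of C f = Idt C y"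
proof -
  obtain g where g: "inverse_arrows C f g"
    using assms(1) by (auto simp: iso_def)
  have "h = g" if h: "inverse_arrows C f h" for h
  proof -
    have "h = h \<cdot> (f \<cdot> g)" "(h \<cdot> f) \<cdot> g = g"
      using g h assms(2) by (auto simp: inverse_arrows_hom Comp_Idt hom_iff)
    moreover have "(h \<cdot> f) \<cdot> g = h \<cdot> (f \<cdot> g)"
      using g h assms(2) by (intro Comp_assoc) (auto simp: inverse_arrows_hom)
    ultimately show ?thesis
      by simp
  qed
  then have "inverse_arrows C f (inverse_of C f)"
    unfolding inverse_of_def by (rule theI[of "inverse_arrows C f", OF g])
  then show "inverse_of C f \<in> hom C y x"
    "inverse_of C f \<cdot> f = Idt C x" "f \<cdot> inverse_of C f = Idt C y"
    using assms(2) by (auto simp: inverse_arrows_hom)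
qed

end

context is_functor
begin

lemma FAr_arr:
  assumes "f \<in> Arr B"
  shows "FAr F f \<in> Arr C" "Dom C (FAr F f) = FOb F (Dom B f)" "Cod C (FAr F f) = FOb F (Cod B f)"
  using FAr_in_hom[of f "Dom B f" "Cod B f"] assms by (auto simp: hom_iff)

lemma FAr_Comp_arr:
  assumes "f \<in> Arr B" "g \<in> Arr B" "Cod B f = Dom B g"
  shows "FAr F (g \<cdot>\<^bsub>B\<^esub> f) = FAr F g \<cdot>\<^bsub>C\<^esub> FAr F f"
  using FAr_Comp[of f "Dom B f" "Cod B f" g "Cod B g"] assms by (auto simp: hom_iff)

lemmas functor_simps = FAr_arr FAr_Comp_arr FAr_Idt FOb_in_Obj

end

lemma id_functor_is_functor: "category B \<Longrightarrow> is_functor B B id_functor"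
  by (simp add: is_functor_def is_functor_axioms_def id_functor_def)

lemma functor_comp_is_functor:
  assumes "is_functor B C F" "is_functor C D G"
  shows "is_functor B D (G \<circ>\<^sub>F F)"
proof -
  interpret F: is_functor B C F by fact
  interpret G: is_functor C D G by fact
  show ?thesis
    by unfold_locales
      (auto simp: functor_comp_def F.FOb_in_Obj G.FOb_in_Obj F.FAr_Idt G.FAr_Idt
        intro: F.FAr_in_hom G.FAr_in_hom F.functor_simps G.functor_simps
        simp: F.FAr_Comp G.FAr_Comp[OF F.FAr_in_hom F.FAr_in_hom])
qed

lemma nat_isoI:
  assumes "is_functor B C F" "is_functor B C G"
    and "\<And>x. x \<in> Obj B \<Longrightarrow> \<tau> x \<in> hom C (FOb F x) (FOb G x)"
    and "\<And>f x y. f \<in> hom B x y \<Longrightarrow> \<tau> y \<cdot>\<^bsub>C\<^esub> FAr F f = FAr G f \<cdot>\<^bsub>C\<^esub> \<tau> x"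
    and "\<And>x. x \<in> Obj B \<Longrightarrow> iso C (\<tau> x)"
  shows "nat_iso B C F G \<tau>"
  using assms by (simp add: nat_iso_def nat_transf_def nat_transf_axioms_def nat_iso_axioms_def)


section \<open>Fully faithful and essentially surjective functors\<close>

locale fully_faithful = is_functor +
  assumes full: "\<lbrakk>x \<in> Obj B; y \<in> Obj B; d \<in> hom C (FOb F x) (FOb F y)\<rbrakk>
      \<Longrightarrow> \<exists>f \<in> hom B x y. FAr F f = d"
    and faithful: "\<lbrakk>f \<in> hom B x y; g \<in> hom B x y; FAr F f = FAr F g\<rbrakk> \<Longrightarrow> f = g"

locale essentially_surjective = is_functor +
  assumes ess_surj: "d \<in> Obj C \<Longrightarrow> \<exists>x \<in> Obj B. \<exists>i \<in> hom C (FOb F x) d. iso C i"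

lemma faithful_if_iso_to_identity:
  assumes "is_functor B D K" "is_functor D B L" "nat_iso B B id_functor (L \<circ>\<^sub>F K) \<alpha>"
    and f: "f \<in> hom B x y" and g: "g \<in> hom B x y" and eq: "FAr K f = FAr K g"
  shows "f = g"
proof -
  interpret K: is_functor B D K by fact
  interpret \<alpha>: nat_iso B B id_functor "L \<circ>\<^sub>F K" \<alpha> by fact
  have x: "x \<in> Obj B" and y: "y \<in> Obj B"
    using K.dom.hom_Obj[OF f] by auto
  have hy: "\<alpha> y \<in> hom B y (FOb L (FOb K y))"
    using \<alpha>.component_in_hom[OF y] by (simp add: id_functor_def functor_comp_def)
  note inv = K.dom.inverse_of_props[OF \<alpha>.component_iso[OF y] hy]
  have "\<alpha> y \<cdot>\<^bsub>B\<^esub> f = \<alpha> y \<cdot>\<^bsub>B\<^esub> g"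
    using \<alpha>.naturality[OF f] \<alpha>.naturality[OF g] eq by (simp add: id_functor_def functor_comp_def)
  then have "inverse_of B (\<alpha> y) \<cdot>\<^bsub>B\<^esub> (\<alpha> y \<cdot>\<^bsub>B\<^esub> f) = inverse_of B (\<alpha> y) \<cdot>\<^bsub>B\<^esub> (\<alpha> y \<cdot>\<^bsub>B\<^esub> g)"
    by simp
  then have "(inverse_of B (\<alpha> y) \<cdot>\<^bsub>B\<^esub> \<alpha> y) \<cdot>\<^bsub>B\<^esub> f = (inverse_of B (\<alpha> y) \<cdot>\<^bsub>B\<^esub> \<alpha> y) \<cdot>\<^bsub>B\<^esub> g"
    using inv(1) hy f g by (simp add: K.dom.Comp_assoc_arr hom_iff)
  then show ?thesis
    using inv(2) f g by (simp add: K.dom.Comp_Idt hom_iff)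
qed

text \<open>Fullness of \<open>K\<close> comes from faithfulness of its quasi-inverse \<open>L\<close>: the conjugate \<open>f\<close> of
  \<open>L d\<close> by the isomorphisms \<open>\<alpha> : id \<Rightarrow> L K\<close> satisfies \<open>L (K f) = L d\<close>.\<close>

lemma equivalence_imp_fully_faithful_essentially_surjective:
  assumes "equivalence B D K"
  shows "fully_faithful B D K" and "essentially_surjective B D K"
proof -
  obtain L \<alpha> \<beta> where K: "is_functor B D K" and L: "is_functor D B L"
    and \<alpha>: "nat_iso B B id_functor (L \<circ>\<^sub>F K) \<alpha>" and \<beta>: "nat_iso D D (K \<circ>\<^sub>F L) id_functor \<beta>"
    using assms by (auto simp: equivalence_def)
  interpret K: is_functor B D K by fact
  interpret L: is_functor D B L by fact
  interpret \<alpha>: nat_iso B B id_functor "L \<circ>\<^sub>F K" \<alpha> by fact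
  interpret \<beta>: nat_iso D D "K \<circ>\<^sub>F L" id_functor \<beta> by fact
  note unf = id_functor_def functor_comp_def
  have \<beta>_hom: "\<beta> d \<in> hom D (FOb K (FOb L d)) d" if "d \<in> Obj D" for d
    using \<beta>.component_in_hom[OF that] by (simp add: unf)
  have \<alpha>_hom: "\<alpha> b \<in> hom B b (FOb L (FOb K b))" if "b \<in> Obj B" for b
    using \<alpha>.component_in_hom[OF that] by (simp add: unf)
  show "essentially_surjective B D K"
    using \<beta>_hom \<beta>.component_iso L.FOb_in_Obj by unfold_locales blast
  have L_faithful: "f = g" if "f \<in> hom D x y" "g \<in> hom D x y" "FAr L f = FAr L g" for f g x y
  proof -
    have x: "x \<in> Obj D" and y: "y \<in> Obj D"
      using K.cod.hom_Obj[OF that(1)] by auto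
    note inv = K.cod.inverse_of_props[OF \<beta>.component_iso[OF x] \<beta>_hom[OF x]]
    have "f \<cdot>\<^bsub>D\<^esub> \<beta> x = g \<cdot>\<^bsub>D\<^esub> \<beta> x"
      using \<beta>.naturality[OF that(1)] \<beta>.naturality[OF that(2)] that(3) by (simp add: unf)
    then show ?thesis
      using K.cod.split_epi_cancel[OF inv(3) \<beta>_hom[OF x] inv(1) that(1,2)] by simp
  qed
  show "fully_faithful B D K"
  proof unfold_locales
    fix x y f g
    assume "f \<in> hom B x y" "g \<in> hom B x y" "FAr K f = FAr K g"
    then show "f = g"
      by (rule faithful_if_iso_to_identity[OF K L \<alpha>])
  next
    fix x y d
    assume x: "x \<in> Obj B" and y: "y \<in> Obj B" and d: "d \<in> hom D (FOb K x) (FOb K y)"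
    note invy = K.dom.inverse_of_props[OF \<alpha>.component_iso[OF y] \<alpha>_hom[OF y]]
    note invx = K.dom.inverse_of_props[OF \<alpha>.component_iso[OF x] \<alpha>_hom[OF x]]
    define f where "f = inverse_of B (\<alpha> y) \<cdot>\<^bsub>B\<^esub> (FAr L d \<cdot>\<^bsub>B\<^esub> \<alpha> x)"
    have f: "f \<in> hom B x y"
      using invy(1) \<alpha>_hom[OF x] d unfolding f_def
      by (simp add: K.dom.arr_simps L.functor_simps)
    have "FAr L (FAr K f) \<cdot>\<^bsub>B\<^esub> \<alpha> x = \<alpha> y \<cdot>\<^bsub>B\<^esub> f"
      using \<alpha>.naturality[OF f] by (simp add: unf)
    also have "\<dots> = (\<alpha> y \<cdot>\<^bsub>B\<^esub> inverse_of B (\<alpha> y)) \<cdot>\<^bsub>B\<^esub> (FAr L d \<cdot>\<^bsub>B\<^esub> \<alpha> x)"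
      using invy(1) \<alpha>_hom[OF x] \<alpha>_hom[OF y] d unfolding f_def
      by (simp add: K.dom.arr_simps L.functor_simps)
    also have "\<dots> = FAr L d \<cdot>\<^bsub>B\<^esub> \<alpha> x"
      using invy(3) \<alpha>_hom[OF x] d by (simp add: K.dom.arr_simps L.functor_simps)
    finally have "FAr L (FAr K f) \<cdot>\<^bsub>B\<^esub> \<alpha> x = FAr L d \<cdot>\<^bsub>B\<^esub> \<alpha> x" .
    moreover have "FAr L (FAr K f) \<in> hom B (FOb L (FOb K x)) (FOb L (FOb K y))"
      "FAr L d \<in> hom B (FOb L (FOb K x)) (FOb L (FOb K y))"
      using f d by (auto simp: hom_iff K.functor_simps L.functor_simps)
    ultimately have "FAr L (FAr K f) = FAr L d"
      using K.dom.split_epi_cancel[OF invx(3) \<alpha>_hom[OF x] invx(1)] by blast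
    then have "FAr K f = d"
      using L_faithful[OF K.FAr_in_hom[OF f] d] by simp
    then show "\<exists>f \<in> hom B x y. FAr K f = d"
      using f by blast
  qed
qed

text \<open>The quasi-inverse \<open>L\<close> sends \<open>d\<close> to a chosen object with an isomorphism \<open>\<beta> d : K (L d) \<rightarrow> d\<close>, and
  an arrow to the preimage under \<open>K\<close> of its conjugate by \<open>\<beta>\<close>.  Every identity required in \<open>B\<close> then
  follows from its image in \<open>D\<close> by faithfulness.\<close>

lemma equivalence_if_fully_faithful_essentially_surjective:
  assumes "fully_faithful B D K" "essentially_surjective B D K"
  shows "equivalence B D K"
proof -
  interpret fully_faithful B D K by fact
  interpret essentially_surjective B D K by fact
  note unf = id_functor_def functor_comp_def
  obtain R \<beta> where R: "\<And>d. d \<in> Obj D \<Longrightarrow> R d \<in> Obj B"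
    and \<beta>: "\<And>d. d \<in> Obj D \<Longrightarrow> \<beta> d \<in> hom D (FOb K (R d)) d"
    and \<beta>_iso: "\<And>d. d \<in> Obj D \<Longrightarrow> iso D (\<beta> d)"
    using ess_surj by metis
  define \<gamma> where "\<gamma> d = inverse_of D (\<beta> d)" for d
  have \<gamma>: "\<gamma> d \<in> hom D d (FOb K (R d))" "\<gamma> d \<cdot>\<^bsub>D\<^esub> \<beta> d = Idt D (FOb K (R d))"
    "\<beta> d \<cdot>\<^bsub>D\<^esub> \<gamma> d = Idt D d" if "d \<in> Obj D" for d
    using cod.inverse_of_props[OF \<beta>_iso[OF that] \<beta>[OF that]] by (auto simp: \<gamma>_def)
  define H where
    "H x y d = (SOME f. f \<in> hom B x y \<and> FAr K f = d)" for x y d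
  have H: "H x y d \<in> hom B x y" "FAr K (H x y d) = d"
    if "x \<in> Obj B" "y \<in> Obj B" "d \<in> hom D (FOb K x) (FOb K y)" for x y d
    using someI_ex[of "\<lambda>f. f \<in> hom B x y \<and> FAr K f = d"] full[OF that] by (auto simp: H_def)
  define L where "L = \<lparr>FOb = R, FAr = (\<lambda>m. H (R (Dom D m)) (R (Cod D m))
    (\<gamma> (Cod D m) \<cdot>\<^bsub>D\<^esub> (m \<cdot>\<^bsub>D\<^esub> \<beta> (Dom D m))))\<rparr>"
  have L_ob: "FOb L d = R d" for d
    by (simp add: L_def)
  have L_ar: "FAr L m \<in> hom B (R x) (R y)" "FAr K (FAr L m) = \<gamma> y \<cdot>\<^bsub>D\<^esub> (m \<cdot>\<^bsub>D\<^esub> \<beta> x)"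
    if m: "m \<in> hom D x y" for m x y
  proof -
    have xy: "x \<in> Obj D" "y \<in> Obj D"
      using cod.hom_Obj[OF m] by auto
    have "\<gamma> y \<cdot>\<^bsub>D\<^esub> (m \<cdot>\<^bsub>D\<^esub> \<beta> x) \<in> hom D (FOb K (R x)) (FOb K (R y))"
      using \<gamma>(1)[OF xy(2)] \<beta>[OF xy(1)] m by (simp add: cod.arr_simps)
    then show "FAr L m \<in> hom B (R x) (R y)" "FAr K (FAr L m) = \<gamma> y \<cdot>\<^bsub>D\<^esub> (m \<cdot>\<^bsub>D\<^esub> \<beta> x)"
      using H[OF R[OF xy(1)] R[OF xy(2)]] m by (auto simp: L_def hom_iff)
  qed
  have L: "is_functor D B L"
  proof unfold_locales
    fix d assume d: "d \<in> Obj D"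
    show "FOb L d \<in> Obj B"
      using R[OF d] by (simp add: L_ob)
    have id: "Idt D d \<in> hom D d d"
      by (rule cod.Idt_in_hom[OF d])
    have "FAr K (FAr L (Idt D d)) = FAr K (Idt B (R d))"
      using L_ar(2)[OF id] \<gamma>[OF d] \<beta>[OF d] d R[OF d] by (simp add: cod.arr_simps FAr_Idt)
    then show "FAr L (Idt D d) = Idt B (FOb L d)"
      using faithful[OF L_ar(1)[OF id] dom.Idt_in_hom[OF R[OF d]]] by (simp add: L_ob)
  next
    fix m x y assume "m \<in> hom D x y"
    then show "FAr L m \<in> hom B (FOb L x) (FOb L y)"
      using L_ar(1) by (simp add: L_ob)
  next
    fix m x y n z assume m: "m \<in> hom D x y" and n: "n \<in> hom D y z"
    have xyz: "x \<in> Obj D" "y \<in> Obj D" "z \<in> Obj D"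
      using cod.hom_Obj[OF m] cod.hom_Obj[OF n] by auto
    note nm = cod.Comp_in_hom[OF m n]
    note homs = \<gamma>(1)[OF xyz(1)] \<gamma>(1)[OF xyz(2)] \<gamma>(1)[OF xyz(3)]
      \<beta>[OF xyz(1)] \<beta>[OF xyz(2)] \<beta>[OF xyz(3)] m n
    have LnLm: "FAr L n \<cdot>\<^bsub>B\<^esub> FAr L m \<in> hom B (R x) (R z)"
      using L_ar(1)[OF m] L_ar(1)[OF n] by (rule dom.Comp_in_hom)
    have "FAr K (FAr L n \<cdot>\<^bsub>B\<^esub> FAr L m) = (\<gamma> z \<cdot>\<^bsub>D\<^esub> (n \<cdot>\<^bsub>D\<^esub> \<beta> y)) \<cdot>\<^bsub>D\<^esub> (\<gamma> y \<cdot>\<^bsub>D\<^esub> (m \<cdot>\<^bsub>D\<^esub> \<beta> x))"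
      using FAr_Comp[OF L_ar(1)[OF m] L_ar(1)[OF n]] L_ar(2)[OF m] L_ar(2)[OF n] by simp
    also have "\<dots> = \<gamma> z \<cdot>\<^bsub>D\<^esub> (n \<cdot>\<^bsub>D\<^esub> ((\<beta> y \<cdot>\<^bsub>D\<^esub> \<gamma> y) \<cdot>\<^bsub>D\<^esub> (m \<cdot>\<^bsub>D\<^esub> \<beta> x)))"
      using homs by (simp add: cod.Comp_arr cod.Comp_assoc_arr hom_iff)
    also have "\<dots> = FAr K (FAr L (n \<cdot>\<^bsub>D\<^esub> m))"
      using homs \<gamma>(3)[OF xyz(2)] L_ar(2)[OF nm] by (simp add: cod.arr_simps)
    finally show "FAr L (n \<cdot>\<^bsub>D\<^esub> m) = FAr L n \<cdot>\<^bsub>B\<^esub> FAr L m"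
      using faithful[OF L_ar(1)[OF nm] LnLm] by simp
  qed
  interpret L: is_functor D B L by fact
  define \<alpha> where "\<alpha> b = H b (R (FOb K b)) (\<gamma> (FOb K b))" for b
  have \<alpha>: "\<alpha> b \<in> hom B b (R (FOb K b))" "FAr K (\<alpha> b) = \<gamma> (FOb K b)" if b: "b \<in> Obj B" for b
    using H[OF b R[OF FOb_in_Obj[OF b]] \<gamma>(1)[OF FOb_in_Obj[OF b]]] by (auto simp: \<alpha>_def)
  have "nat_iso B B id_functor (L \<circ>\<^sub>F K) \<alpha>"
  proof (rule nat_isoI[OF id_functor_is_functor[OF dom.category_axioms]
        functor_comp_is_functor[OF is_functor_axioms L]])
    fix b assume b: "b \<in> Obj B"
    let ?d = "FOb K b"
    have d: "?d \<in> Obj D" and Rd: "R ?d \<in> Obj B"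
      using FOb_in_Obj[OF b] R by auto
    obtain h where h: "h \<in> hom B (R ?d) b" "FAr K h = \<beta> ?d"
      using full[OF Rd b \<beta>[OF d]] by blast
    have "h \<cdot>\<^bsub>B\<^esub> \<alpha> b = Idt B b"
      using h \<alpha>[OF b] \<gamma>(3)[OF d] FAr_Comp[OF \<alpha>(1)[OF b] h(1)] FAr_Idt[OF b]
      by (intro faithful[OF dom.Comp_in_hom[OF \<alpha>(1)[OF b] h(1)] dom.Idt_in_hom[OF b]]) simp
    moreover have "\<alpha> b \<cdot>\<^bsub>B\<^esub> h = Idt B (R ?d)"
      using h \<alpha>[OF b] \<gamma>(2)[OF d] FAr_Comp[OF h(1) \<alpha>(1)[OF b]] FAr_Idt[OF Rd]
      by (intro faithful[OF dom.Comp_in_hom[OF h(1) \<alpha>(1)[OF b]] dom.Idt_in_hom[OF Rd]]) simp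
    ultimately show "iso B (\<alpha> b)"
      using h(1) dom.inverse_arrows_hom[OF \<alpha>(1)[OF b]] by (auto simp: iso_def)
  next
    fix b assume "b \<in> Obj B"
    then show "\<alpha> b \<in> hom B (FOb id_functor b) (FOb (L \<circ>\<^sub>F K) b)"
      using \<alpha>(1) by (simp add: unf L_ob)
  next
    fix f x y assume f: "f \<in> hom B x y"
    have xy: "x \<in> Obj B" "y \<in> Obj B"
      using dom.hom_Obj[OF f] by auto
    note dxy = FOb_in_Obj[OF xy(1)] FOb_in_Obj[OF xy(2)]
    note Kf = FAr_in_hom[OF f]
    note l = dom.Comp_in_hom[OF f \<alpha>(1)[OF xy(2)]]
    note r = dom.Comp_in_hom[OF \<alpha>(1)[OF xy(1)] L_ar(1)[OF Kf]]
    have "FAr K (FAr L (FAr K f) \<cdot>\<^bsub>B\<^esub> \<alpha> x)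
        = (\<gamma> (FOb K y) \<cdot>\<^bsub>D\<^esub> (FAr K f \<cdot>\<^bsub>D\<^esub> \<beta> (FOb K x))) \<cdot>\<^bsub>D\<^esub> \<gamma> (FOb K x)"
      using FAr_Comp[OF \<alpha>(1)[OF xy(1)] L_ar(1)[OF Kf]] L_ar(2)[OF Kf] \<alpha>(2)[OF xy(1)] by simp
    also have "\<dots> = \<gamma> (FOb K y) \<cdot>\<^bsub>D\<^esub> FAr K f"
      using \<gamma>[OF dxy(1)] \<gamma>(1)[OF dxy(2)] \<beta>[OF dxy(1)] Kf by (simp add: cod.arr_simps)
    also have "\<dots> = FAr K (\<alpha> y \<cdot>\<^bsub>B\<^esub> f)"
      using FAr_Comp[OF f \<alpha>(1)[OF xy(2)]] \<alpha>(2)[OF xy(2)] by simp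
    finally show "\<alpha> y \<cdot>\<^bsub>B\<^esub> FAr id_functor f = FAr (L \<circ>\<^sub>F K) f \<cdot>\<^bsub>B\<^esub> \<alpha> x"
      using faithful[OF l r] by (simp add: unf)
  qed
  moreover have "nat_iso D D (K \<circ>\<^sub>F L) id_functor \<beta>"
  proof (rule nat_isoI[OF functor_comp_is_functor[OF L is_functor_axioms]
        id_functor_is_functor[OF cod.category_axioms]])
    fix m x y assume m: "m \<in> hom D x y"
    have xy: "x \<in> Obj D" "y \<in> Obj D"
      using cod.hom_Obj[OF m] by auto
    have "\<beta> y \<cdot>\<^bsub>D\<^esub> FAr K (FAr L m) = (\<beta> y \<cdot>\<^bsub>D\<^esub> \<gamma> y) \<cdot>\<^bsub>D\<^esub> (m \<cdot>\<^bsub>D\<^esub> \<beta> x)"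
      using L_ar(2)[OF m] \<gamma>(1)[OF xy(2)] \<beta>[OF xy(1)] \<beta>[OF xy(2)] m
      by (simp add: cod.arr_simps)
    also have "\<dots> = m \<cdot>\<^bsub>D\<^esub> \<beta> x"
      using \<gamma>(3)[OF xy(2)] \<beta>[OF xy(1)] m by (simp add: cod.arr_simps)
    finally show "\<beta> y \<cdot>\<^bsub>D\<^esub> FAr (K \<circ>\<^sub>F L) m = FAr id_functor m \<cdot>\<^bsub>D\<^esub> \<beta> x"
      by (simp add: unf)
  qed (use \<beta> \<beta>_iso in \<open>auto simp: unf L_ob\<close>)
  ultimately show ?thesis
    using L is_functor_axioms unfolding equivalence_def by blast
qed


section \<open>Commuting squares\<close>

text \<open>In \<open>square C f u v g\<close> the arrows \<open>f\<close> and \<open>g\<close> are parallel sides, \<open>f\<close> over the domains and \<open>g\<close> over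
  the codomains of \<open>u\<close> and \<open>v\<close>.  An arrow \<open>m\<close> is compatible with descent data \<open>\<phi>\<close> and \<open>\<psi>\<close> when it gives
  such a square with \<open>f = \<phi>\<close>, \<open>g = \<psi>\<close>, \<open>u = \<A>(d\<^sup>1)(m)\<close> and \<open>v = \<A>(d\<^sup>0)(m)\<close>, and the naturality squares of
  \<open>\<A>(\<sigma>\<^sub>i\<^sub>j)\<close> have the same form.  Hence the two sides of the cocycle equation are
  compared by pasting squares, without reassociating long composites.\<close>

definition square :: "('o, 'm) category \<Rightarrow> 'm \<Rightarrow> 'm \<Rightarrow> 'm \<Rightarrow> 'm \<Rightarrow> bool" where
  "square C f u v g \<longleftrightarrow>
     u \<in> Arr C \<and> v \<in> Arr C \<and> f \<in> hom C (Dom C u) (Dom C v) \<and> g \<in> hom C (Cod C u) (Cod C v) \<and>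
     v \<cdot>\<^bsub>C\<^esub> f = g \<cdot>\<^bsub>C\<^esub> u"

lemma square_homs:
  assumes "square C f u v g"
  shows "u \<in> Arr C" "v \<in> Arr C" "f \<in> Arr C" "Dom C f = Dom C u" "Cod C f = Dom C v"
    "g \<in> Arr C" "Dom C g = Cod C u" "Cod C g = Cod C v"
  using assms by (auto simp: square_def hom_iff)

lemma square_eq: "square C f u v g \<Longrightarrow> v \<cdot>\<^bsub>C\<^esub> f = g \<cdot>\<^bsub>C\<^esub> u"
  by (simp add: square_def)

context category
begin

lemma squareI:
  assumes "f \<in> hom C x y" "u \<in> hom C x x'" "v \<in> hom C y y'" "g \<in> hom C x' y'"
    and "v \<cdot> f = g \<cdot> u"
  shows "square C f u v g"
  using assms by (simp add: square_def hom_iff)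

lemma square_paste:
  assumes "square C f u v g" "square C f' v w g'"
  shows "square C (f' \<cdot> f) u w (g' \<cdot> g)"
proof -
  note homs = square_homs[OF assms(1)] square_homs[OF assms(2)]
  have "w \<cdot> (f' \<cdot> f) = (w \<cdot> f') \<cdot> f"
    using homs by (simp add: Comp_assoc_arr)
  also have "\<dots> = g' \<cdot> (v \<cdot> f)"
    unfolding square_eq[OF assms(2)] using homs by (simp add: Comp_assoc_arr)
  also have "\<dots> = (g' \<cdot> g) \<cdot> u"
    unfolding square_eq[OF assms(1)] using homs by (simp add: Comp_assoc_arr)
  finally show ?thesis
    using homs by (simp add: square_def hom_iff Comp_arr)
qed

lemma square_stack:
  assumes "square C f u v g" "square C g u' v' h"
  shows "square C f (u' \<cdot> u) (v' \<cdot> v) h"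
proof -
  note homs = square_homs[OF assms(1)] square_homs[OF assms(2)]
  have "(v' \<cdot> v) \<cdot> f = v' \<cdot> (v \<cdot> f)"
    using homs by (simp add: Comp_assoc_arr)
  also have "\<dots> = (v' \<cdot> g) \<cdot> u"
    unfolding square_eq[OF assms(1)] using homs by (simp add: Comp_assoc_arr)
  also have "\<dots> = h \<cdot> (u' \<cdot> u)"
    unfolding square_eq[OF assms(2)] using homs by (simp add: Comp_assoc_arr)
  finally show ?thesis
    using homs by (simp add: square_def hom_iff Comp_arr)
qed

lemma square_inverse:
  assumes "square C f u v g" "iso C f" "iso C g"
  shows "square C (inverse_of C f) v u (inverse_of C g)"
proof -
  have u: "u \<in> hom C (Dom C u) (Cod C u)" and v: "v \<in> hom C (Dom C v) (Cod C v)"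
    and f: "f \<in> hom C (Dom C u) (Dom C v)" and g: "g \<in> hom C (Cod C u) (Cod C v)"
    and eq: "v \<cdot> f = g \<cdot> u"
    using assms(1) by (auto simp: square_def hom_iff)
  let ?f = "inverse_of C f" and ?g = "inverse_of C g"
  note f' = inverse_of_props[OF assms(2) f] and g' = inverse_of_props[OF assms(3) g]
  have "(u \<cdot> ?f) = (?g \<cdot> g) \<cdot> (u \<cdot> ?f)"
    using u f' g'(2) by (simp add: Comp_arr Comp_Idt hom_iff)
  also have "\<dots> = ?g \<cdot> ((g \<cdot> u) \<cdot> ?f)"
    using u g f'(1) g'(1) by (simp add: Comp_arr Comp_assoc_arr hom_iff)
  also have "\<dots> = ?g \<cdot> (v \<cdot> (f \<cdot> ?f))"
    unfolding eq[symmetric] using v f f'(1) by (simp add: Comp_arr Comp_assoc_arr hom_iff)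
  also have "\<dots> = ?g \<cdot> v"
    using v f'(3) by (simp add: Comp_arr Comp_Idt hom_iff)
  finally show ?thesis
    using u v f' g' by (intro squareI)
qed

text \<open>The cancellation that carries equations between descent structures from the domain of a split
  epimorphism to its codomain.\<close>

lemma square_determined:
  assumes "square C f u v g" "square C f u v g'" "u \<cdot> s = Idt C y" "u \<in> hom C x y" "s \<in> hom C y x"
  shows "g = g'"
  using split_epi_cancel[OF assms(3-5), of g "Cod C v" g'] assms(1,2,4)
  by (auto simp: square_def hom_iff)

text \<open>For a split epimorphism compatible with two structures, compatibility of a composite passes to
  the factor that follows the split epimorphism.\<close>

lemma square_descends:
  assumes "square C f u v g" "square C f (u' \<cdot> u) (v' \<cdot> v) h"
    and "u \<cdot> s = Idt C y" "u \<in> hom C x y" "s \<in> hom C y x" "u' \<in> hom C y y'"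
    and "v' \<in> Arr C" "Dom C v' = Cod C v"
  shows "square C g u' v' h"
proof -
  have "(v' \<cdot> g) \<cdot> u = v' \<cdot> (g \<cdot> u)" "v' \<cdot> (v \<cdot> f) = (v' \<cdot> v) \<cdot> f" "h \<cdot> (u' \<cdot> u) = (h \<cdot> u') \<cdot> u"
    using assms by (auto simp: square_def hom_iff Comp_arr Comp_assoc_arr)
  then have "(v' \<cdot> g) \<cdot> u = (h \<cdot> u') \<cdot> u"
    using assms(1,2) by (simp add: square_def)
  moreover have "v' \<cdot> g \<in> hom C y (Cod C v')" "h \<cdot> u' \<in> hom C y (Cod C v')"
    using assms by (auto simp: square_def hom_iff Comp_arr)
  ultimately have "v' \<cdot> g = h \<cdot> u'"
    using split_epi_cancel[OF assms(3-5)] by blast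
  then show ?thesis
    using assms by (simp add: square_def hom_iff Comp_arr)
qed

end

lemma (in is_functor) square_image:
  assumes "square B f u v g"
  shows "square C (FAr F f) (FAr F u) (FAr F v) (FAr F g)"
proof -
  note homs = square_homs[OF assms]
  have "FAr F v \<cdot>\<^bsub>C\<^esub> FAr F f = FAr F (v \<cdot>\<^bsub>B\<^esub> f)"
    using homs by (simp add: FAr_Comp_arr)
  also have "\<dots> = FAr F g \<cdot>\<^bsub>C\<^esub> FAr F u"
    unfolding square_eq[OF assms] using homs by (simp add: FAr_Comp_arr)
  finally show ?thesis
    using homs by (simp add: square_def hom_iff FAr_arr)
qed

lemma (in nat_transf) naturality_square:
  assumes "f \<in> hom B x y"
  shows "square C (\<tau> x) (FAr F f) (FAr G f) (\<tau> y)"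
  using F.dom.hom_Obj[OF assms] component_in_hom F.FAr_in_hom[OF assms] G.FAr_in_hom[OF assms]
    naturality[OF assms]
  by (intro F.cod.squareI[of _ "FOb F x" "FOb G x" _ "FOb F y" _ "FOb G y"]) auto

text \<open>As \<open>e\<close> coequalizes \<open>f\<close> and \<open>g\<close>, which are compatible with the structures, \<open>Q e \<cdot> \<phi>'\<close> coequalizes
  \<open>P f\<close> and \<open>P g\<close>.  The splitting turns this into a factorization through \<open>P e\<close>:
  \<open>Q e \<cdot> \<phi>' \<cdot> P (s \<cdot> e) = Q e \<cdot> \<phi>' \<cdot> P f \<cdot> P t = Q e \<cdot> \<phi>' \<cdot> P g \<cdot> P t = Q e \<cdot> \<phi>'\<close>.\<close>

lemma split_fork_structure:
  assumes "is_functor C D P" "is_functor C D Q"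
    and "f \<in> hom C w'' w'" "g \<in> hom C w'' w'" "e \<in> hom C w' w"
    and "t \<in> hom C w' w''" "s \<in> hom C w w'"
    and fork: "e \<cdot>\<^bsub>C\<^esub> f = e \<cdot>\<^bsub>C\<^esub> g" "g \<cdot>\<^bsub>C\<^esub> t = Idt C w'" "f \<cdot>\<^bsub>C\<^esub> t = s \<cdot>\<^bsub>C\<^esub> e"
    and f_sq: "square D \<phi>'' (FAr P f) (FAr Q f) \<phi>'"
    and g_sq: "square D \<phi>'' (FAr P g) (FAr Q g) \<phi>'"
  shows "square D \<phi>' (FAr P e) (FAr Q e) (FAr Q e \<cdot>\<^bsub>D\<^esub> (\<phi>' \<cdot>\<^bsub>D\<^esub> FAr P s))"
proof -
  interpret P: is_functor C D P by fact
  interpret Q: is_functor C D Q by fact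
  note homs = assms(3-7)[unfolded hom_iff]
  have \<phi>: "\<phi>' \<in> hom D (FOb P w') (FOb Q w')" "\<phi>'' \<in> hom D (FOb P w'') (FOb Q w'')"
    using f_sq homs by (auto simp: square_def hom_iff P.functor_simps Q.functor_simps)
  note typing = P.functor_simps Q.functor_simps P.dom.Comp_arr P.cod.Comp_arr hom_iff
  note assoc = P.cod.Comp_assoc_arr
  have f_eq: "FAr Q f \<cdot>\<^bsub>D\<^esub> \<phi>'' = \<phi>' \<cdot>\<^bsub>D\<^esub> FAr P f"
    and g_eq: "FAr Q g \<cdot>\<^bsub>D\<^esub> \<phi>'' = \<phi>' \<cdot>\<^bsub>D\<^esub> FAr P g"
    using f_sq g_sq by (simp_all add: square_def)
  have "(FAr Q e \<cdot>\<^bsub>D\<^esub> (\<phi>' \<cdot>\<^bsub>D\<^esub> FAr P s)) \<cdot>\<^bsub>D\<^esub> FAr P e = FAr Q e \<cdot>\<^bsub>D\<^esub> (\<phi>' \<cdot>\<^bsub>D\<^esub> FAr P (s \<cdot>\<^bsub>C\<^esub> e))"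
    using homs \<phi> by (simp add: typing assoc)
  also have "\<dots> = FAr Q e \<cdot>\<^bsub>D\<^esub> ((\<phi>' \<cdot>\<^bsub>D\<^esub> FAr P f) \<cdot>\<^bsub>D\<^esub> FAr P t)"
    using homs \<phi> unfolding fork(3)[symmetric] by (simp add: typing assoc)
  also have "\<dots> = FAr Q (e \<cdot>\<^bsub>C\<^esub> f) \<cdot>\<^bsub>D\<^esub> (\<phi>'' \<cdot>\<^bsub>D\<^esub> FAr P t)"
    using homs \<phi> unfolding f_eq[symmetric] by (simp add: typing assoc)
  also have "\<dots> = FAr Q e \<cdot>\<^bsub>D\<^esub> ((FAr Q g \<cdot>\<^bsub>D\<^esub> \<phi>'') \<cdot>\<^bsub>D\<^esub> FAr P t)"
    unfolding fork(1) using homs \<phi> by (simp add: typing assoc)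
  also have "\<dots> = FAr Q e \<cdot>\<^bsub>D\<^esub> (\<phi>' \<cdot>\<^bsub>D\<^esub> FAr P (g \<cdot>\<^bsub>C\<^esub> t))"
    unfolding g_eq using homs \<phi> by (simp add: typing assoc)
  also have "\<dots> = FAr Q e \<cdot>\<^bsub>D\<^esub> \<phi>'"
    unfolding fork(2) using homs \<phi> P.dom.Dom_in_Obj[of e] by (simp add: typing P.cod.Comp_Idt)
  finally have "(FAr Q e \<cdot>\<^bsub>D\<^esub> (\<phi>' \<cdot>\<^bsub>D\<^esub> FAr P s)) \<cdot>\<^bsub>D\<^esub> FAr P e = FAr Q e \<cdot>\<^bsub>D\<^esub> \<phi>'" .
  then show ?thesis
    using homs \<phi> by (simp add: square_def typing)
qed


section \<open>The Eilenberg-Moore category and the comparison functor\<close>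

lemma structured_category_hom:
  "h \<in> hom (structured_category C X P) p q \<longleftrightarrow>
     (\<exists>m. h = (p, m, q) \<and> p \<in> X \<and> q \<in> X \<and> m \<in> hom C (fst p) (fst q) \<and> P p m q)"
  by (auto simp: structured_category_def hom_def)

lemma structured_category_sel:
  "Obj (structured_category C X P) = X"
  "Idt (structured_category C X P) p = (p, Idt C (fst p), p)"
  "(p', n, q') \<cdot>\<^bsub>structured_category C X P\<^esub> (p, m, q) = (p, n \<cdot>\<^bsub>C\<^esub> m, q')"
  "(p, m, q) \<in> Arr (structured_category C X P) \<longleftrightarrow>
     p \<in> X \<and> q \<in> X \<and> m \<in> hom C (fst p) (fst q) \<and> P p m q"
  "Dom (structured_category C X P) (p, m, q) = p"
  "Cod (structured_category C X P) (p, m, q) = q"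
  by (auto simp: structured_category_def)

lemma category_structured_category:
  assumes "category C"
    and obj: "\<And>p. p \<in> X \<Longrightarrow> fst p \<in> Obj C"
    and idt: "\<And>p. p \<in> X \<Longrightarrow> P p (Idt C (fst p)) p"
    and comp: "\<And>p q r m n. \<lbrakk>p \<in> X; q \<in> X; r \<in> X; m \<in> hom C (fst p) (fst q);
      n \<in> hom C (fst q) (fst r); P p m q; P q n r\<rbrakk> \<Longrightarrow> P p (n \<cdot>\<^bsub>C\<^esub> m) r"
  shows "category (structured_category C X P)" (is "category ?S")
proof -
  interpret category C by fact
  note sel = structured_category_hom structured_category_sel
  show ?thesis
  proof unfold_locales
    fix f assume "f \<in> Arr ?S"
    then show "Dom ?S f \<in> Obj ?S" "Cod ?S f \<in> Obj ?S"
      by (auto simp: structured_category_def)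
  next
    fix x assume "x \<in> Obj ?S"
    then show "Idt ?S x \<in> hom ?S x x"
      using obj idt by (simp add: sel Idt_in_hom)
  next
    fix f g x y z assume "f \<in> hom ?S x y" "g \<in> hom ?S y z"
    then show "g \<cdot>\<^bsub>?S\<^esub> f \<in> hom ?S x z"
      unfolding structured_category_hom
      by (elim exE conjE) (simp add: sel comp[of x y z] Comp_in_hom[of _ "fst x" "fst y" _ "fst z"])
  next
    fix f x y assume "f \<in> hom ?S x y"
    then show "Idt ?S y \<cdot>\<^bsub>?S\<^esub> f = f" "f \<cdot>\<^bsub>?S\<^esub> Idt ?S x = f"
      unfolding structured_category_hom
      by (elim exE conjE, simp add: sel Comp_Idt_left Comp_Idt_right)+
  next
    fix f g h w x y z assume "f \<in> hom ?S w x" "g \<in> hom ?S x y" "h \<in> hom ?S y z"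
    then show "(h \<cdot>\<^bsub>?S\<^esub> g) \<cdot>\<^bsub>?S\<^esub> f = h \<cdot>\<^bsub>?S\<^esub> (g \<cdot>\<^bsub>?S\<^esub> f)"
      unfolding structured_category_hom
      by (elim exE conjE) (simp add: sel Comp_assoc[of _ "fst w" "fst x" _ "fst y" _ "fst z"])
  qed
qed

lemma structured_category_isoI:
  assumes "inverse_arrows C m n"
    and "(p, m, q) \<in> hom (structured_category C X P) p q"
    and "(q, n, p) \<in> hom (structured_category C X P) q p"
  shows "iso (structured_category C X P) (p, m, q)"
  unfolding iso_def
proof
  show "inverse_arrows (structured_category C X P) (p, m, q) (q, n, p)"
    using assms by (simp add: inverse_arrows_def structured_category_hom structured_category_sel hom_iff)
qed

lemma EM_category_hom:
  "h \<in> hom (EM_category C T \<eta> \<mu>) p q \<longleftrightarrow>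
     (\<exists>m. h = (p, m, q) \<and> p \<in> EM_algebras C T \<eta> \<mu> \<and> q \<in> EM_algebras C T \<eta> \<mu> \<and>
        m \<in> hom C (fst p) (fst q) \<and> m \<cdot>\<^bsub>C\<^esub> snd p = snd q \<cdot>\<^bsub>C\<^esub> FAr T m)"
  by (cases p; cases q) (simp add: EM_category_def structured_category_hom)

lemma EM_category_is_category:
  assumes "is_functor C C T"
  shows "category (EM_category C T \<eta> \<mu>)"
proof -
  interpret T: is_functor C C T by fact
  show ?thesis
    unfolding EM_category_def
  proof (rule category_structured_category[OF T.dom.category_axioms])
    fix p assume p: "p \<in> EM_algebras C T \<eta> \<mu>"
    then show "fst p \<in> Obj C"
      by (auto simp: EM_algebras_def)
    obtain x a where "p = (x, a)"
      by (cases p)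
    then show "(case p of (x, a) \<Rightarrow> \<lambda>m (y, b). m \<cdot>\<^bsub>C\<^esub> a = b \<cdot>\<^bsub>C\<^esub> FAr T m) (Idt C (fst p)) p"
      using p by (simp add: EM_algebras_def T.FAr_Idt T.dom.Comp_Idt hom_iff)
  next
    fix p q r m n
    assume alg: "p \<in> EM_algebras C T \<eta> \<mu>" "q \<in> EM_algebras C T \<eta> \<mu>" "r \<in> EM_algebras C T \<eta> \<mu>"
      and m: "m \<in> hom C (fst p) (fst q)" and n: "n \<in> hom C (fst q) (fst r)"
      and sq: "(case p of (x, a) \<Rightarrow> \<lambda>m (y, b). m \<cdot>\<^bsub>C\<^esub> a = b \<cdot>\<^bsub>C\<^esub> FAr T m) m q"
        "(case q of (x, a) \<Rightarrow> \<lambda>m (y, b). m \<cdot>\<^bsub>C\<^esub> a = b \<cdot>\<^bsub>C\<^esub> FAr T m) n r"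
    obtain x a y b z c where pqr: "p = (x, a)" "q = (y, b)" "r = (z, c)"
      by (cases p; cases q; cases r) blast
    have abc: "a \<in> hom C (FOb T x) x" "b \<in> hom C (FOb T y) y" "c \<in> hom C (FOb T z) z"
      using alg by (auto simp: pqr EM_algebras_def)
    have mn: "m \<in> hom C x y" "n \<in> hom C y z"
      and sq: "m \<cdot>\<^bsub>C\<^esub> a = b \<cdot>\<^bsub>C\<^esub> FAr T m" "n \<cdot>\<^bsub>C\<^esub> b = c \<cdot>\<^bsub>C\<^esub> FAr T n"
      using m n sq by (simp_all add: pqr)
    note typing = hom_iff T.functor_simps T.dom.Comp_arr T.dom.Comp_assoc_arr
    have "(n \<cdot>\<^bsub>C\<^esub> m) \<cdot>\<^bsub>C\<^esub> a = n \<cdot>\<^bsub>C\<^esub> (m \<cdot>\<^bsub>C\<^esub> a)"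
      using abc mn by (simp add: typing)
    also have "\<dots> = (n \<cdot>\<^bsub>C\<^esub> b) \<cdot>\<^bsub>C\<^esub> FAr T m"
      unfolding sq(1) using abc mn by (simp add: typing)
    also have "\<dots> = c \<cdot>\<^bsub>C\<^esub> FAr T (n \<cdot>\<^bsub>C\<^esub> m)"
      unfolding sq(2) using abc mn by (simp add: typing)
    finally show "(case p of (x, a) \<Rightarrow> \<lambda>m (y, b). m \<cdot>\<^bsub>C\<^esub> a = b \<cdot>\<^bsub>C\<^esub> FAr T m) (n \<cdot>\<^bsub>C\<^esub> m) r"
      by (simp add: pqr)
  qed
qed

context adjunction
begin

lemma counit_hom: "b \<in> Obj B \<Longrightarrow> \<epsilon> b \<in> hom B (FOb F (FOb G b)) b"
  using counit.component_in_hom[of b] by (simp add: functor_comp_def id_functor_def)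

lemma unit_hom: "c \<in> Obj C \<Longrightarrow> \<eta> c \<in> hom C c (FOb G (FOb F c))"
  using unit.component_in_hom[of c] by (simp add: functor_comp_def id_functor_def)

lemma counit_naturality:
  "f \<in> hom B b b' \<Longrightarrow> \<epsilon> b' \<cdot>\<^bsub>B\<^esub> FAr F (FAr G f) = f \<cdot>\<^bsub>B\<^esub> \<epsilon> b"
  using counit.naturality[of f b b'] by (simp add: functor_comp_def id_functor_def)

lemma unit_naturality:
  "m \<in> hom C c c' \<Longrightarrow> \<eta> c' \<cdot>\<^bsub>C\<^esub> m = FAr G (FAr F m) \<cdot>\<^bsub>C\<^esub> \<eta> c"
  using unit.naturality[of m c c'] by (simp add: functor_comp_def id_functor_def)

lemma EM_algebra_iff:
  "(x, a) \<in> EM_algebras C (G \<circ>\<^sub>F F) \<eta> (induced_mult F G \<epsilon>) \<longleftrightarrow>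
     x \<in> Obj C \<and> a \<in> hom C (FOb G (FOb F x)) x \<and> a \<cdot>\<^bsub>C\<^esub> \<eta> x = Idt C x \<and>
     a \<cdot>\<^bsub>C\<^esub> FAr G (FAr F a) = a \<cdot>\<^bsub>C\<^esub> FAr G (\<epsilon> (FOb F x))"
  by (simp add: EM_algebras_def functor_comp_def induced_mult_def)

lemma EM_hom:
  "h \<in> hom (EM_of_adjunction C F G \<eta> \<epsilon>) p q \<longleftrightarrow>
     (\<exists>m. h = (p, m, q) \<and> p \<in> EM_algebras C (G \<circ>\<^sub>F F) \<eta> (induced_mult F G \<epsilon>) \<and>
        q \<in> EM_algebras C (G \<circ>\<^sub>F F) \<eta> (induced_mult F G \<epsilon>) \<and>
        m \<in> hom C (fst p) (fst q) \<and> m \<cdot>\<^bsub>C\<^esub> snd p = snd q \<cdot>\<^bsub>C\<^esub> FAr G (FAr F m))"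
  by (simp add: EM_category_hom functor_comp_def)

lemma comparison_algebra:
  assumes b: "b \<in> Obj B"
  shows "(FOb G b, FAr G (\<epsilon> b)) \<in> EM_algebras C (G \<circ>\<^sub>F F) \<eta> (induced_mult F G \<epsilon>)"
proof -
  note e = counit_hom[OF b]
  have GFe: "FAr F (FAr G (\<epsilon> b)) \<in> hom B (FOb F (FOb G (FOb F (FOb G b)))) (FOb F (FOb G b))"
    by (rule F.FAr_in_hom[OF G.FAr_in_hom[OF e]])
  have Fb: "FOb F (FOb G b) \<in> Obj B"
    using F.FOb_in_Obj G.FOb_in_Obj b by blast
  have "FAr G (\<epsilon> b) \<cdot>\<^bsub>C\<^esub> FAr G (FAr F (FAr G (\<epsilon> b))) = FAr G (\<epsilon> b \<cdot>\<^bsub>B\<^esub> FAr F (FAr G (\<epsilon> b)))"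
    by (rule G.FAr_Comp[OF GFe e, symmetric])
  also have "\<dots> = FAr G (\<epsilon> b) \<cdot>\<^bsub>C\<^esub> FAr G (\<epsilon> (FOb F (FOb G b)))"
    unfolding counit_naturality[OF e] by (rule G.FAr_Comp[OF counit_hom[OF Fb] e])
  finally show ?thesis
    using b G.FOb_in_Obj G.FAr_in_hom[OF e] triangle_G[OF b] by (simp add: EM_algebra_iff)
qed

text \<open>The inverse of an isomorphism of \<open>C\<close> commutes with algebra structures as soon as the
  isomorphism does, so isomorphisms of algebras may be checked in one direction only.\<close>

lemma inverse_algebra_hom:
  assumes i: "i \<in> hom C y x" and ij: "inverse_arrows C i j"
    and a: "a \<in> hom C (FOb G (FOb F x)) x" and c: "c \<in> hom C (FOb G (FOb F y)) y"
    and sq: "j \<cdot>\<^bsub>C\<^esub> a = c \<cdot>\<^bsub>C\<^esub> FAr G (FAr F j)"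
  shows "i \<cdot>\<^bsub>C\<^esub> c = a \<cdot>\<^bsub>C\<^esub> FAr G (FAr F i)"
proof -
  have j: "j \<in> hom C x y" and ji: "j \<cdot>\<^bsub>C\<^esub> i = Idt C y" "i \<cdot>\<^bsub>C\<^esub> j = Idt C x"
    using ij F.dom.inverse_arrows_hom[OF i] by blast+
  note GFi = G.FAr_in_hom[OF F.FAr_in_hom[OF i]] and GFj = G.FAr_in_hom[OF F.FAr_in_hom[OF j]]
  have "FAr G (FAr F j) \<cdot>\<^bsub>C\<^esub> FAr G (FAr F i) = Idt C (FOb G (FOb F y))"
    unfolding G.FAr_Comp[OF F.FAr_in_hom[OF i] F.FAr_in_hom[OF j], symmetric]
      F.FAr_Comp[OF i j, symmetric] ji(1)
    using F.dom.hom_Obj[OF i] by (simp add: F.FAr_Idt G.FAr_Idt F.FOb_in_Obj)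
  then have "i \<cdot>\<^bsub>C\<^esub> c = i \<cdot>\<^bsub>C\<^esub> ((c \<cdot>\<^bsub>C\<^esub> FAr G (FAr F j)) \<cdot>\<^bsub>C\<^esub> FAr G (FAr F i))"
    using F.dom.Comp_assoc[OF GFi GFj c] F.dom.Comp_Idt_right[OF c] by simp
  also have "\<dots> = (i \<cdot>\<^bsub>C\<^esub> j) \<cdot>\<^bsub>C\<^esub> (a \<cdot>\<^bsub>C\<^esub> FAr G (FAr F i))"
    unfolding sq[symmetric] using i j a GFi
    by (simp add: F.dom.Comp_arr F.dom.Comp_assoc_arr hom_iff)
  also have "\<dots> = a \<cdot>\<^bsub>C\<^esub> FAr G (FAr F i)"
    unfolding ji(2) by (rule F.dom.Comp_Idt_left[OF F.dom.Comp_in_hom[OF GFi a]])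
  finally show ?thesis .
qed

lemma comparison_functor_sel:
  "FOb (comparison_functor B G \<epsilon>) b = (FOb G b, FAr G (\<epsilon> b))"
  "f \<in> hom B b b' \<Longrightarrow> FAr (comparison_functor B G \<epsilon>) f
     = ((FOb G b, FAr G (\<epsilon> b)), FAr G f, (FOb G b', FAr G (\<epsilon> b')))"
  by (simp_all add: comparison_functor_def Let_def hom_iff)

lemma comparison_is_functor:
  "is_functor B (EM_of_adjunction C F G \<eta> \<epsilon>) (comparison_functor B G \<epsilon>)"
proof -
  let ?K = "comparison_functor B G \<epsilon>" and ?EM = "EM_of_adjunction C F G \<eta> \<epsilon>"
  interpret EM: category ?EM
    by (rule EM_category_is_category[OF
          functor_comp_is_functor[OF F.is_functor_axioms G.is_functor_axioms]])
  show ?thesis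
  proof unfold_locales
    fix b assume b: "b \<in> Obj B"
    show "FOb ?K b \<in> Obj ?EM"
      using comparison_algebra[OF b]
      by (simp add: comparison_functor_sel EM_category_def structured_category_sel)
    show "FAr ?K (Idt B b) = Idt ?EM (FOb ?K b)"
      using comparison_functor_sel(2)[OF F.cod.Idt_in_hom[OF b]] G.FAr_Idt[OF b]
      by (simp add: comparison_functor_sel(1) EM_category_def structured_category_sel)
  next
    fix f x y assume f: "f \<in> hom B x y"
    note xy = F.cod.hom_Obj[OF f]
    note GFf = F.FAr_in_hom[OF G.FAr_in_hom[OF f]]
    have "FAr G f \<cdot>\<^bsub>C\<^esub> FAr G (\<epsilon> x) = FAr G (f \<cdot>\<^bsub>B\<^esub> \<epsilon> x)"
      by (rule G.FAr_Comp[OF counit_hom[OF xy(1)] f, symmetric])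
    also have "\<dots> = FAr G (\<epsilon> y) \<cdot>\<^bsub>C\<^esub> FAr G (FAr F (FAr G f))"
      unfolding counit_naturality[OF f, symmetric] by (rule G.FAr_Comp[OF GFf counit_hom[OF xy(2)]])
    finally show "FAr ?K f \<in> hom ?EM (FOb ?K x) (FOb ?K y)"
      using comparison_algebra xy G.FAr_in_hom[OF f]
      by (simp add: EM_hom comparison_functor_sel(1) comparison_functor_sel(2)[OF f])
  next
    fix f x y g z assume f: "f \<in> hom B x y" and g: "g \<in> hom B y z"
    show "FAr ?K (g \<cdot>\<^bsub>B\<^esub> f) = FAr ?K g \<cdot>\<^bsub>?EM\<^esub> FAr ?K f"
      by (simp add: comparison_functor_sel(2)[OF f] comparison_functor_sel(2)[OF g] G.FAr_Comp[OF f g]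
          comparison_functor_sel(2)[OF F.cod.Comp_in_hom[OF f g]]
          EM_category_def structured_category_sel)
  qed
qed

end


section \<open>Lax descent data along split epimorphisms\<close>

context pseudofunctor
begin

lemma PComp_iso:
  assumes "g \<in> hom S x y" "h \<in> hom S y z" "w \<in> Obj (PObj \<A> x)"
  shows "iso (PObj \<A> z) (PComp \<A> h g w)"
  using nat_iso.component_iso[OF PComp_nat_iso[OF assms(1,2)] assms(3)] .

lemma PComp_square:
  assumes "g \<in> hom S x y" "h \<in> hom S y z" "m \<in> hom (PObj \<A> x) w w'"
  shows "square (PObj \<A> z) (PComp \<A> h g w) (FAr (PArr \<A> h) (FAr (PArr \<A> g) m))
           (FAr (PArr \<A> (h \<cdot>\<^bsub>S\<^esub> g)) m) (PComp \<A> h g w')"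
proof -
  interpret nat_iso "PObj \<A> x" "PObj \<A> z" "PArr \<A> h \<circ>\<^sub>F PArr \<A> g" "PArr \<A> (h \<cdot>\<^bsub>S\<^esub> g)" "PComp \<A> h g"
    by (rule PComp_nat_iso[OF assms(1,2)])
  show ?thesis
    using naturality_square[OF assms(3)] by (simp add: functor_comp_def)
qed

lemma PUnit_square:
  assumes "x \<in> Obj S" "m \<in> hom (PObj \<A> x) w w'"
  shows "square (PObj \<A> x) (PUnit \<A> x w) m (FAr (PArr \<A> (Idt S x)) m) (PUnit \<A> x w')"
    and "iso (PObj \<A> x) (PUnit \<A> x w)" and "iso (PObj \<A> x) (PUnit \<A> x w')"
proof -
  interpret X: category "PObj \<A> x"
    by (rule PObj_category[OF assms(1)])
  interpret nat_iso "PObj \<A> x" "PObj \<A> x" id_functor "PArr \<A> (Idt S x)" "PUnit \<A> x"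
    by (rule PUnit_nat_iso[OF assms(1)])
  show "square (PObj \<A> x) (PUnit \<A> x w) m (FAr (PArr \<A> (Idt S x)) m) (PUnit \<A> x w')"
    using naturality_square[OF assms(2)] by (simp add: id_functor_def)
  show "iso (PObj \<A> x) (PUnit \<A> x w)" "iso (PObj \<A> x) (PUnit \<A> x w')"
    using component_iso X.hom_Obj[OF assms(2)] by auto
qed

text \<open>The coherence isomorphisms \<open>\<A>(\<sigma>\<^sub>i\<^sub>j)\<close> compare the two factorizations of one arrow of \<open>S\<close>;
  they are instances of this composite and are natural because both of its factors are.\<close>

lemma exchange_square:
  assumes g: "g \<in> hom S x y" and h: "h \<in> hom S y z"
    and g': "g' \<in> hom S x y'" and h': "h' \<in> hom S y' z"
    and eq: "h \<cdot>\<^bsub>S\<^esub> g = h' \<cdot>\<^bsub>S\<^esub> g'" and m: "m \<in> hom (PObj \<A> x) w w'"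
  shows "square (PObj \<A> z)
           (inverse_of (PObj \<A> z) (PComp \<A> h' g' w) \<cdot>\<^bsub>PObj \<A> z\<^esub> PComp \<A> h g w)
           (FAr (PArr \<A> h) (FAr (PArr \<A> g) m)) (FAr (PArr \<A> h') (FAr (PArr \<A> g') m))
           (inverse_of (PObj \<A> z) (PComp \<A> h' g' w') \<cdot>\<^bsub>PObj \<A> z\<^esub> PComp \<A> h g w')"
proof -
  interpret X: category "PObj \<A> x"
    using S.hom_Obj[OF g] PObj_category by blast
  interpret Z: category "PObj \<A> z"
    using S.hom_Obj[OF h] PObj_category by blast
  note w = X.hom_Obj[OF m]
  show ?thesis
    using PComp_square[OF g h m, unfolded eq]
      Z.square_inverse[OF PComp_square[OF g' h' m] PComp_iso[OF g' h' w(1)]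
        PComp_iso[OF g' h' w(2)]]
    by (rule Z.square_paste)
qed

text \<open>The same for \<open>nn \<A> i\<close>, which compares a split pair of \<open>S\<close> with an identity.\<close>

lemma retraction_square:
  assumes g: "g \<in> hom S x y" and h: "h \<in> hom S y x"
    and eq: "h \<cdot>\<^bsub>S\<^esub> g = Idt S x" and m: "m \<in> hom (PObj \<A> x) w w'"
  shows "square (PObj \<A> x)
           (inverse_of (PObj \<A> x) (PUnit \<A> x w) \<cdot>\<^bsub>PObj \<A> x\<^esub> PComp \<A> h g w)
           (FAr (PArr \<A> h) (FAr (PArr \<A> g) m)) m
           (inverse_of (PObj \<A> x) (PUnit \<A> x w') \<cdot>\<^bsub>PObj \<A> x\<^esub> PComp \<A> h g w')"
proof -
  have x: "x \<in> Obj S"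
    using S.hom_Obj[OF g] by blast
  interpret X: category "PObj \<A> x"
    by (rule PObj_category[OF x])
  show ?thesis
    using PComp_square[OF g h m, unfolded eq] X.square_inverse[OF PUnit_square[OF x m]]
    by (rule X.square_paste)
qed

end

lemma Delta3_generator_hom:
  "i \<in> {0, 1} \<Longrightarrow> \<d> i \<in> hom Delta3 1 2"
  "i \<in> {0, 1, 2} \<Longrightarrow> \<DD> i \<in> hom Delta3 2 3"
  "\<s>\<^sub>0 \<in> hom Delta3 2 1"
proof -
  show "\<d> i \<in> hom Delta3 1 2" if "i \<in> {0, 1}"
    using Delta3_arrows.d[OF that] that
    by (auto simp: hom_iff Delta3_def ord_cat_def coface_def upt_rec)
  show "\<DD> i \<in> hom Delta3 2 3" if "i \<in> {0, 1, 2}"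
    using Delta3_arrows.D[OF that] that
    by (auto simp: hom_iff Delta3_def ord_cat_def coface_def upt_rec)
  show "\<s>\<^sub>0 \<in> hom Delta3 2 1"
    using Delta3_arrows.s by (simp add: hom_iff Delta3_def ord_cat_def s_degen_def)
qed

locale descent_diagram = pseudofunctor Delta3 \<A>
  for \<A> :: "(nat, ordmap, 'o, 'm) pseudo_data"
begin

lemma generator_homs:
  "\<d> 0 \<in> hom Delta3 1 2" "\<d> 1 \<in> hom Delta3 1 2"
  "\<DD> 0 \<in> hom Delta3 2 3" "\<DD> 1 \<in> hom Delta3 2 3" "\<DD> 2 \<in> hom Delta3 2 3"
  by (rule Delta3_generator_hom; simp)+

sublocale d0: is_functor "PObj \<A> 1" "PObj \<A> 2" "PArr \<A> (\<d> 0)"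
  by (rule PArr_functor[OF generator_homs(1)])
sublocale d1: is_functor "PObj \<A> 1" "PObj \<A> 2" "PArr \<A> (\<d> 1)"
  by (rule PArr_functor[OF generator_homs(2)])
sublocale D0: is_functor "PObj \<A> 2" "PObj \<A> 3" "PArr \<A> (\<DD> 0)"
  by (rule PArr_functor[OF generator_homs(3)])
sublocale D1: is_functor "PObj \<A> 2" "PObj \<A> 3" "PArr \<A> (\<DD> 1)"
  by (rule PArr_functor[OF generator_homs(4)])
sublocale D2: is_functor "PObj \<A> 2" "PObj \<A> 3" "PArr \<A> (\<DD> 2)"
  by (rule PArr_functor[OF generator_homs(5)])
sublocale s0: is_functor "PObj \<A> 2" "PObj \<A> 1" "PArr \<A> \<s>\<^sub>0"
  by (rule PArr_functor[OF Delta3_generator_hom(3)])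

text \<open>Both sides of the cocycle equation for \<open>\<phi>'\<close> and \<open>\<phi>\<close> are linked by pasted squares from
  \<open>\<A>(D\<^sup>2) \<A>(d\<^sup>1) (e)\<close> to \<open>\<A>(D\<^sup>0) \<A>(d\<^sup>0) (e)\<close>; the former is again a split epimorphism, so equality of
  the sides for \<open>\<phi>'\<close> forces it for \<open>\<phi>\<close>.  The unit equation is cancelled in the same way along
  \<open>\<A>(s\<^sup>0) \<A>(d\<^sup>1) (e)\<close>.\<close>

lemma descent_datum_descends:
  assumes datum: "(w', \<phi>') \<in> lax_descent_data \<A>"
    and e: "e \<in> hom (PObj \<A> 1) w' w" and s: "s \<in> hom (PObj \<A> 1) w w'"
    and es: "e \<cdot>\<^bsub>PObj \<A> 1\<^esub> s = Idt (PObj \<A> 1) w"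
    and sq: "square (PObj \<A> 2) \<phi>' (FAr (PArr \<A> (\<d> 1)) e) (FAr (PArr \<A> (\<d> 0)) e) \<phi>"
  shows "(w, \<phi>) \<in> lax_descent_data \<A>"
proof -
  let ?d0 = "PArr \<A> (\<d> 0)" and ?d1 = "PArr \<A> (\<d> 1)" and ?s0 = "PArr \<A> \<s>\<^sub>0"
    and ?D0 = "PArr \<A> (\<DD> 0)" and ?D1 = "PArr \<A> (\<DD> 1)" and ?D2 = "PArr \<A> (\<DD> 2)"
  note w = d0.dom.hom_Obj(2)[OF e]
  note gh = generator_homs
  have s01: "square (PObj \<A> 3) (sigma01 \<A> w') (FAr ?D1 (FAr ?d0 e)) (FAr ?D0 (FAr ?d0 e)) (sigma01 \<A> w)"
    unfolding sigma01_def by (rule exchange_square[OF gh(1,4,1,3) Delta3_relations(3) e])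
  have s02: "square (PObj \<A> 3) (sigma02 \<A> w') (FAr ?D2 (FAr ?d0 e)) (FAr ?D0 (FAr ?d1 e)) (sigma02 \<A> w)"
    unfolding sigma02_def by (rule exchange_square[OF gh(1,5,2,3) Delta3_relations(4) e])
  have s12: "square (PObj \<A> 3) (sigma12 \<A> w') (FAr ?D2 (FAr ?d1 e)) (FAr ?D1 (FAr ?d1 e)) (sigma12 \<A> w)"
    unfolding sigma12_def by (rule exchange_square[OF gh(2,5,2,4) Delta3_relations(5) e])
  have n0: "square (PObj \<A> 1) (nn \<A> 0 w') (FAr ?s0 (FAr ?d0 e)) e (nn \<A> 0 w)"
    unfolding nn_def by (rule retraction_square[OF gh(1) Delta3_generator_hom(3) Delta3_relations(1) e])
  have n1: "square (PObj \<A> 1) (nn \<A> 1 w') (FAr ?s0 (FAr ?d1 e)) e (nn \<A> 1 w)"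
    unfolding nn_def by (rule retraction_square[OF gh(2) Delta3_generator_hom(3) Delta3_relations(2) e])
  have d1_split: "FAr ?d1 e \<cdot>\<^bsub>PObj \<A> 2\<^esub> FAr ?d1 s = Idt (PObj \<A> 2) (FOb ?d1 w)"
    using d1.FAr_Comp[OF s e] d1.FAr_Idt[OF w] es by simp
  note d1e = d1.FAr_in_hom[OF e] and d1s = d1.FAr_in_hom[OF s]
  have D2_split: "FAr ?D2 (FAr ?d1 e) \<cdot>\<^bsub>PObj \<A> 3\<^esub> FAr ?D2 (FAr ?d1 s)
      = Idt (PObj \<A> 3) (FOb ?D2 (FOb ?d1 w))"
    using D2.FAr_Comp[OF d1s d1e] D2.FAr_Idt[OF d1.FOb_in_Obj[OF w]] d1_split by simp
  have s0_split: "FAr ?s0 (FAr ?d1 e) \<cdot>\<^bsub>PObj \<A> 1\<^esub> FAr ?s0 (FAr ?d1 s)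
      = Idt (PObj \<A> 1) (FOb ?s0 (FOb ?d1 w))"
    using s0.FAr_Comp[OF d1s d1e] s0.FAr_Idt[OF d1.FOb_in_Obj[OF w]] d1_split by simp
  have "FAr ?D0 \<phi> \<cdot>\<^bsub>PObj \<A> 3\<^esub> sigma02 \<A> w \<cdot>\<^bsub>PObj \<A> 3\<^esub> FAr ?D2 \<phi>
      = sigma01 \<A> w \<cdot>\<^bsub>PObj \<A> 3\<^esub> FAr ?D1 \<phi> \<cdot>\<^bsub>PObj \<A> 3\<^esub> sigma12 \<A> w"
  proof (rule D0.cod.square_determined[OF _ _ D2_split D2.FAr_in_hom[OF d1e] D2.FAr_in_hom[OF d1s]])
    show "square (PObj \<A> 3)
        (FAr ?D0 \<phi>' \<cdot>\<^bsub>PObj \<A> 3\<^esub> sigma02 \<A> w' \<cdot>\<^bsub>PObj \<A> 3\<^esub> FAr ?D2 \<phi>')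
        (FAr ?D2 (FAr ?d1 e)) (FAr ?D0 (FAr ?d0 e))
        (FAr ?D0 \<phi> \<cdot>\<^bsub>PObj \<A> 3\<^esub> sigma02 \<A> w \<cdot>\<^bsub>PObj \<A> 3\<^esub> FAr ?D2 \<phi>)"
      by (rule D0.cod.square_paste[OF D2.square_image[OF sq]
            D0.cod.square_paste[OF s02 D0.square_image[OF sq]]])
    have "square (PObj \<A> 3)
        (sigma01 \<A> w' \<cdot>\<^bsub>PObj \<A> 3\<^esub> FAr ?D1 \<phi>' \<cdot>\<^bsub>PObj \<A> 3\<^esub> sigma12 \<A> w')
        (FAr ?D2 (FAr ?d1 e)) (FAr ?D0 (FAr ?d0 e))
        (sigma01 \<A> w \<cdot>\<^bsub>PObj \<A> 3\<^esub> FAr ?D1 \<phi> \<cdot>\<^bsub>PObj \<A> 3\<^esub> sigma12 \<A> w)"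
      by (rule D0.cod.square_paste[OF s12 D0.cod.square_paste[OF D1.square_image[OF sq] s01]])
    then show "square (PObj \<A> 3)
        (FAr ?D0 \<phi>' \<cdot>\<^bsub>PObj \<A> 3\<^esub> sigma02 \<A> w' \<cdot>\<^bsub>PObj \<A> 3\<^esub> FAr ?D2 \<phi>')
        (FAr ?D2 (FAr ?d1 e)) (FAr ?D0 (FAr ?d0 e))
        (sigma01 \<A> w \<cdot>\<^bsub>PObj \<A> 3\<^esub> FAr ?D1 \<phi> \<cdot>\<^bsub>PObj \<A> 3\<^esub> sigma12 \<A> w)"
      using datum unfolding lax_descent_data_def by simp
  qed
  moreover have "nn \<A> 0 w \<cdot>\<^bsub>PObj \<A> 1\<^esub> FAr ?s0 \<phi> = nn \<A> 1 w"
  proof (rule d0.dom.square_determined[OF _ n1 s0_split s0.FAr_in_hom[OF d1e] s0.FAr_in_hom[OF d1s]])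
    have "square (PObj \<A> 1) (nn \<A> 0 w' \<cdot>\<^bsub>PObj \<A> 1\<^esub> FAr ?s0 \<phi>') (FAr ?s0 (FAr ?d1 e)) e
        (nn \<A> 0 w \<cdot>\<^bsub>PObj \<A> 1\<^esub> FAr ?s0 \<phi>)"
      by (rule d0.dom.square_paste[OF s0.square_image[OF sq] n0])
    then show "square (PObj \<A> 1) (nn \<A> 1 w') (FAr ?s0 (FAr ?d1 e)) e
        (nn \<A> 0 w \<cdot>\<^bsub>PObj \<A> 1\<^esub> FAr ?s0 \<phi>)"
      using datum unfolding lax_descent_data_def by simp
  qed
  moreover have "\<phi> \<in> hom (PObj \<A> 2) (FOb ?d1 w) (FOb ?d0 w)"
    using square_homs[OF sq] d1e d0.FAr_in_hom[OF e] by (simp add: hom_iff)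
  ultimately show ?thesis
    using w unfolding lax_descent_data_def by simp
qed

lemma lax_Desc_hom:
  "h \<in> hom (lax_Desc \<A>) (w, \<phi>) (w', \<phi>') \<longleftrightarrow>
     (\<exists>m. h = ((w, \<phi>), m, (w', \<phi>')) \<and>
        (w, \<phi>) \<in> lax_descent_data \<A> \<and> (w', \<phi>') \<in> lax_descent_data \<A> \<and>
        m \<in> hom (PObj \<A> 1) w w' \<and>
        square (PObj \<A> 2) \<phi> (FAr (PArr \<A> (\<d> 1)) m) (FAr (PArr \<A> (\<d> 0)) m) \<phi>')"
  (is "_ \<longleftrightarrow> (\<exists>m. ?R m)")
proof -
  have "h \<in> hom (lax_Desc \<A>) (w, \<phi>) (w', \<phi>') \<longleftrightarrow>
     (\<exists>m. h = ((w, \<phi>), m, (w', \<phi>')) \<and>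
        (w, \<phi>) \<in> lax_descent_data \<A> \<and> (w', \<phi>') \<in> lax_descent_data \<A> \<and>
        m \<in> hom (PObj \<A> 1) w w' \<and>
        FAr (PArr \<A> (\<d> 0)) m \<cdot>\<^bsub>PObj \<A> 2\<^esub> \<phi> = \<phi>' \<cdot>\<^bsub>PObj \<A> 2\<^esub> FAr (PArr \<A> (\<d> 1)) m)"
    (is "_ \<longleftrightarrow> (\<exists>m. ?Q m)")
    unfolding lax_Desc_def structured_category_hom by simp
  moreover have "?Q m \<longleftrightarrow> ?R m" for m
    by (auto simp: square_def lax_descent_data_def hom_iff d0.FAr_arr d1.FAr_arr simp del: One_nat_def)
  ultimately show ?thesis
    by simp
qed

end


section \<open>Monadicity\<close>

text \<open>A factorization of \<open>G\<close> through an equivalence onto the lax descent category, with arrows of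
  descent data replaced by their underlying arrows: \<open>\<phi> b\<close> is the structure part of the image of \<open>b\<close>,
  and the assumptions after \<open>base\<close> say that the equivalence is a functor into the lax descent
  category, full, faithful and essentially surjective.  In \<open>lift_datum\<close> the arrow \<open>j\<close> is the direction
  of the isomorphism along which structure is transported back to \<open>b\<close>.\<close>

locale adjunction_over_descent = adjunction B C F G \<eta> \<epsilon> + descent_diagram \<A>
  for B :: "('ob, 'mb) category" and C :: "('o, 'm) category"
    and F :: "('o, 'm, 'ob, 'mb) fctr" and G :: "('ob, 'mb, 'o, 'm) fctr"
    and \<eta> :: "'o \<Rightarrow> 'm" and \<epsilon> :: "'ob \<Rightarrow> 'mb"
    and \<A> :: "(nat, ordmap, 'o, 'm) pseudo_data" +
  fixes \<phi> :: "'ob \<Rightarrow> 'm"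
  assumes base: "PObj \<A> 1 = C"
    and datum: "b \<in> Obj B \<Longrightarrow> (FOb G b, \<phi> b) \<in> lax_descent_data \<A>"
    and arrow_square: "f \<in> hom B b b' \<Longrightarrow>
      square (PObj \<A> 2) (\<phi> b) (FAr (PArr \<A> (\<d> 1)) (FAr G f)) (FAr (PArr \<A> (\<d> 0)) (FAr G f)) (\<phi> b')"
    and lift_arrow: "\<lbrakk>b \<in> Obj B; b' \<in> Obj B; m \<in> hom C (FOb G b) (FOb G b');
      square (PObj \<A> 2) (\<phi> b) (FAr (PArr \<A> (\<d> 1)) m) (FAr (PArr \<A> (\<d> 0)) m) (\<phi> b')\<rbrakk>
      \<Longrightarrow> \<exists>f \<in> hom B b b'. FAr G f = m"
    and lift_arrow_unique: "\<lbrakk>f \<in> hom B b b'; g \<in> hom B b b'; FAr G f = FAr G g\<rbrakk> \<Longrightarrow> f = g"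
    and lift_datum: "(x, \<psi>) \<in> lax_descent_data \<A> \<Longrightarrow>
      \<exists>b \<in> Obj B. \<exists>i \<in> hom C (FOb G b) x. \<exists>j. inverse_arrows C i j \<and>
        square (PObj \<A> 2) \<psi> (FAr (PArr \<A> (\<d> 1)) j) (FAr (PArr \<A> (\<d> 0)) j) (\<phi> b)"
begin

lemma d_functors:
  "is_functor C (PObj \<A> 2) (PArr \<A> (\<d> 0))" "is_functor C (PObj \<A> 2) (PArr \<A> (\<d> 1))"
  using d0.is_functor_axioms d1.is_functor_axioms unfolding base by blast+

lemma category_2: "category (PObj \<A> 2)"
  by (rule is_functor.axioms(2)[OF d_functors(1)])

text \<open>Since \<open>m\<close> is an algebra homomorphism, \<open>m \<cdot> G \<epsilon>\<^sub>b\<close> is the image under \<open>G\<close> of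
  \<open>\<epsilon>\<^sub>b\<^sub>' \<cdot> F m\<close> and hence compatible with the data; the arrow \<open>G \<epsilon>\<^sub>b\<close> is split by the unit and can be
  cancelled.\<close>

lemma algebra_hom_lifts:
  assumes b: "b \<in> Obj B" "b' \<in> Obj B" and m: "m \<in> hom C (FOb G b) (FOb G b')"
    and alg: "m \<cdot>\<^bsub>C\<^esub> FAr G (\<epsilon> b) = FAr G (\<epsilon> b') \<cdot>\<^bsub>C\<^esub> FAr G (FAr F m)"
  shows "\<exists>f \<in> hom B b b'. FAr G f = m"
proof -
  let ?d0 = "PArr \<A> (\<d> 0)" and ?d1 = "PArr \<A> (\<d> 1)"
  interpret d0: is_functor C "PObj \<A> 2" ?d0 by (rule d_functors)
  interpret d1: is_functor C "PObj \<A> 2" ?d1 by (rule d_functors)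
  note Gb = G.FOb_in_Obj[OF b(1)]
  note e = counit_hom[OF b(1)] and e' = counit_hom[OF b(2)] and Fm = F.FAr_in_hom[OF m]
  note Ge = G.FAr_in_hom[OF e] and u = unit_hom[OF Gb]
  have Gk: "FAr G (\<epsilon> b' \<cdot>\<^bsub>B\<^esub> FAr F m) = m \<cdot>\<^bsub>C\<^esub> FAr G (\<epsilon> b)"
    using G.FAr_Comp[OF Fm e'] alg by simp
  have "square (PObj \<A> 2) (\<phi> (FOb F (FOb G b)))
      (FAr ?d1 m \<cdot>\<^bsub>PObj \<A> 2\<^esub> FAr ?d1 (FAr G (\<epsilon> b)))
      (FAr ?d0 m \<cdot>\<^bsub>PObj \<A> 2\<^esub> FAr ?d0 (FAr G (\<epsilon> b))) (\<phi> b')"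
    using arrow_square[OF F.cod.Comp_in_hom[OF Fm e']]
    unfolding Gk d0.FAr_Comp[OF Ge m] d1.FAr_Comp[OF Ge m] .
  moreover have "FAr ?d1 (FAr G (\<epsilon> b)) \<cdot>\<^bsub>PObj \<A> 2\<^esub> FAr ?d1 (\<eta> (FOb G b))
      = Idt (PObj \<A> 2) (FOb ?d1 (FOb G b))"
    using d1.FAr_Comp[OF u Ge] triangle_G[OF b(1)] d1.FAr_Idt[OF Gb] by simp
  ultimately have "square (PObj \<A> 2) (\<phi> b) (FAr ?d1 m) (FAr ?d0 m) (\<phi> b')"
    using d0.FAr_in_hom[OF Ge] d0.FAr_in_hom[OF m]
    by (intro category.square_descends[OF category_2 arrow_square[OF e] _ _
          d1.FAr_in_hom[OF Ge] d1.FAr_in_hom[OF u] d1.FAr_in_hom[OF m]])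
      (auto simp: hom_iff)
  then show ?thesis
    by (rule lift_arrow[OF b m])
qed

text \<open>The unit and multiplication laws, the naturality of the unit and a triangle identity say that
  \<open>a\<close> is a split coequalizer of \<open>G F a\<close> and \<open>G \<epsilon>\<^sub>F\<^sub>x\<close>, along which the datum of \<open>F x\<close> descends.\<close>

lemma algebra_datum:
  assumes alg: "(x, a) \<in> EM_algebras C (G \<circ>\<^sub>F F) \<eta> (induced_mult F G \<epsilon>)"
  shows "\<exists>\<psi>. (x, \<psi>) \<in> lax_descent_data \<A> \<and>
    square (PObj \<A> 2) (\<phi> (FOb F x)) (FAr (PArr \<A> (\<d> 1)) a) (FAr (PArr \<A> (\<d> 0)) a) \<psi>"
proof -
  let ?d0 = "PArr \<A> (\<d> 0)" and ?d1 = "PArr \<A> (\<d> 1)"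
  have x: "x \<in> Obj C" and a: "a \<in> hom C (FOb G (FOb F x)) x"
    and a_unit: "a \<cdot>\<^bsub>C\<^esub> \<eta> x = Idt C x"
    and a_mult: "a \<cdot>\<^bsub>C\<^esub> FAr G (FAr F a) = a \<cdot>\<^bsub>C\<^esub> FAr G (\<epsilon> (FOb F x))"
    using alg by (auto simp: EM_algebra_iff)
  have Fx: "FOb F x \<in> Obj B"
    by (rule F.FOb_in_Obj[OF x])
  note Fa = F.FAr_in_hom[OF a] and e = counit_hom[OF Fx]
  define \<psi> where
    "\<psi> = FAr ?d0 a \<cdot>\<^bsub>PObj \<A> 2\<^esub> (\<phi> (FOb F x) \<cdot>\<^bsub>PObj \<A> 2\<^esub> FAr ?d1 (\<eta> x))"
  have sq: "square (PObj \<A> 2) (\<phi> (FOb F x)) (FAr ?d1 a) (FAr ?d0 a) \<psi>"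
    unfolding \<psi>_def
    by (rule split_fork_structure[OF d_functors(2,1) G.FAr_in_hom[OF Fa] G.FAr_in_hom[OF e] a
          unit_hom[OF G.FOb_in_Obj[OF Fx]] unit_hom[OF x] a_mult triangle_G[OF Fx]
          unit_naturality[OF a, symmetric] arrow_square[OF Fa] arrow_square[OF e]])
  have "(x, \<psi>) \<in> lax_descent_data \<A>"
    by (rule descent_datum_descends[OF datum[OF Fx] _ _ _ sq])
      (use a unit_hom[OF x] a_unit base in simp_all)
  then show ?thesis
    using sq by blast
qed

text \<open>The isomorphism \<open>j\<close> from \<open>x\<close> to \<open>G b\<close> respects the descent data, hence so does \<open>j \<cdot> a\<close>, which
  therefore is \<open>G g\<close> for some \<open>g : F x \<rightarrow> b\<close>.  The transpose of \<open>g\<close> is \<open>j \<cdot> a \<cdot> \<eta> x = j\<close>, so that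
  \<open>g = \<epsilon> b \<cdot> F j\<close>; applying \<open>G\<close> gives the condition for \<open>j\<close> to be an algebra homomorphism.\<close>

lemma algebra_from_object:
  assumes alg: "(x, a) \<in> EM_algebras C (G \<circ>\<^sub>F F) \<eta> (induced_mult F G \<epsilon>)"
  shows "\<exists>b \<in> Obj B. \<exists>i \<in> hom C (FOb G b) x. \<exists>j. inverse_arrows C i j \<and>
    j \<cdot>\<^bsub>C\<^esub> a = FAr G (\<epsilon> b) \<cdot>\<^bsub>C\<^esub> FAr G (FAr F j)"
proof -
  let ?d0 = "PArr \<A> (\<d> 0)" and ?d1 = "PArr \<A> (\<d> 1)"
  interpret d0: is_functor C "PObj \<A> 2" ?d0 by (rule d_functors)
  interpret d1: is_functor C "PObj \<A> 2" ?d1 by (rule d_functors)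
  have x: "x \<in> Obj C" and a: "a \<in> hom C (FOb G (FOb F x)) x" and a_unit: "a \<cdot>\<^bsub>C\<^esub> \<eta> x = Idt C x"
    using alg by (auto simp: EM_algebra_iff)
  have Fx: "FOb F x \<in> Obj B"
    by (rule F.FOb_in_Obj[OF x])
  obtain \<psi> where \<psi>: "(x, \<psi>) \<in> lax_descent_data \<A>"
    and a_sq: "square (PObj \<A> 2) (\<phi> (FOb F x)) (FAr ?d1 a) (FAr ?d0 a) \<psi>"
    using algebra_datum[OF alg] by blast
  obtain b i j where b: "b \<in> Obj B" and i: "i \<in> hom C (FOb G b) x" and ij: "inverse_arrows C i j"
    and j_sq: "square (PObj \<A> 2) \<psi> (FAr ?d1 j) (FAr ?d0 j) (\<phi> b)"
    using lift_datum[OF \<psi>] by blast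
  have j: "j \<in> hom C x (FOb G b)"
    using ij F.dom.inverse_arrows_hom[OF i] by blast
  note ja = F.dom.Comp_in_hom[OF a j]
  have "square (PObj \<A> 2) (\<phi> (FOb F x)) (FAr ?d1 (j \<cdot>\<^bsub>C\<^esub> a)) (FAr ?d0 (j \<cdot>\<^bsub>C\<^esub> a)) (\<phi> b)"
    using category.square_stack[OF category_2 a_sq j_sq]
    unfolding d0.FAr_Comp[OF a j] d1.FAr_Comp[OF a j] .
  then obtain g where g: "g \<in> hom B (FOb F x) b" and Gg: "FAr G g = j \<cdot>\<^bsub>C\<^esub> a"
    using lift_arrow[OF Fx b ja] by blast
  \<comment> \<open>\<open>g\<close> and \<open>\<epsilon> b \<cdot> F j\<close> have the same transpose \<open>j\<close>.\<close>
  have g_eq: "\<epsilon> b \<cdot>\<^bsub>B\<^esub> FAr F j = g"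
  proof -
    note u = unit_hom[OF x]
    note Fu = F.FAr_in_hom[OF u] and GFg = G.FAr_in_hom[OF g]
    have "j = FAr G g \<cdot>\<^bsub>C\<^esub> \<eta> x"
      unfolding Gg using F.dom.Comp_assoc[OF u a j] F.dom.Comp_Idt_right[OF j] a_unit by simp
    then have "FAr F j = FAr F (FAr G g) \<cdot>\<^bsub>B\<^esub> FAr F (\<eta> x)"
      using F.FAr_Comp[OF u GFg] by simp
    then have "\<epsilon> b \<cdot>\<^bsub>B\<^esub> FAr F j = (\<epsilon> b \<cdot>\<^bsub>B\<^esub> FAr F (FAr G g)) \<cdot>\<^bsub>B\<^esub> FAr F (\<eta> x)"
      using F.cod.Comp_assoc[OF Fu F.FAr_in_hom[OF GFg] counit_hom[OF b]] by simp
    also have "\<dots> = g \<cdot>\<^bsub>B\<^esub> (\<epsilon> (FOb F x) \<cdot>\<^bsub>B\<^esub> FAr F (\<eta> x))"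
      unfolding counit_naturality[OF g] by (rule F.cod.Comp_assoc[OF Fu counit_hom[OF Fx] g])
    also have "\<dots> = g"
      unfolding triangle_F[OF x] by (rule F.cod.Comp_Idt_right[OF g])
    finally show ?thesis .
  qed
  have "j \<cdot>\<^bsub>C\<^esub> a = FAr G (\<epsilon> b) \<cdot>\<^bsub>C\<^esub> FAr G (FAr F j)"
    using G.FAr_Comp[OF F.FAr_in_hom[OF j] counit_hom[OF b]] g_eq Gg by simp
  then show ?thesis
    using b i ij by blast
qed

lemma comparison_is_equivalence:
  "equivalence B (EM_of_adjunction C F G \<eta> \<epsilon>) (comparison_functor B G \<epsilon>)"
proof (rule equivalence_if_fully_faithful_essentially_surjective)
  let ?K = "comparison_functor B G \<epsilon>" and ?EM = "EM_of_adjunction C F G \<eta> \<epsilon>"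
  interpret K: is_functor B ?EM ?K
    by (rule comparison_is_functor)
  show "fully_faithful B ?EM ?K"
  proof unfold_locales
    fix x y d
    assume xy: "x \<in> Obj B" "y \<in> Obj B" and d: "d \<in> hom ?EM (FOb ?K x) (FOb ?K y)"
    obtain m where m: "d = (FOb ?K x, m, FOb ?K y)" "m \<in> hom C (FOb G x) (FOb G y)"
      "m \<cdot>\<^bsub>C\<^esub> FAr G (\<epsilon> x) = FAr G (\<epsilon> y) \<cdot>\<^bsub>C\<^esub> FAr G (FAr F m)"
      using d by (auto simp: EM_hom comparison_functor_sel)
    show "\<exists>f \<in> hom B x y. FAr ?K f = d"
      using algebra_hom_lifts[OF xy m(2,3)] m(1) comparison_functor_sel by auto
  next
    fix f g x y
    assume "f \<in> hom B x y" "g \<in> hom B x y" "FAr ?K f = FAr ?K g"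
    then show "f = g"
      using lift_arrow_unique comparison_functor_sel(2) by auto
  qed
  show "essentially_surjective B ?EM ?K"
  proof unfold_locales
    fix p assume "p \<in> Obj ?EM"
    then obtain x a where p: "p = (x, a)"
      and alg: "(x, a) \<in> EM_algebras C (G \<circ>\<^sub>F F) \<eta> (induced_mult F G \<epsilon>)"
      by (cases p) (auto simp: EM_category_def structured_category_sel)
    obtain b i j where b: "b \<in> Obj B" and i: "i \<in> hom C (FOb G b) x" and ij: "inverse_arrows C i j"
      and j_alg: "j \<cdot>\<^bsub>C\<^esub> a = FAr G (\<epsilon> b) \<cdot>\<^bsub>C\<^esub> FAr G (FAr F j)"
      using algebra_from_object[OF alg] by blast
    have a: "a \<in> hom C (FOb G (FOb F x)) x"
      using alg by (simp add: EM_algebra_iff)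
    have j: "j \<in> hom C x (FOb G b)"
      using ij F.dom.inverse_arrows_hom[OF i] by blast
    have i_hom: "(FOb ?K b, i, p) \<in> hom ?EM (FOb ?K b) p"
      using inverse_algebra_hom[OF i ij a G.FAr_in_hom[OF counit_hom[OF b]] j_alg] i alg
        comparison_algebra[OF b]
      by (simp add: EM_hom p comparison_functor_sel)
    have j_hom: "(p, j, FOb ?K b) \<in> hom ?EM p (FOb ?K b)"
      using j_alg j alg comparison_algebra[OF b] by (simp add: EM_hom p comparison_functor_sel)
    have "iso ?EM (FOb ?K b, i, p)"
      using structured_category_isoI[OF ij] i_hom j_hom unfolding EM_category_def by blast
    then show "\<exists>b \<in> Obj B. \<exists>i \<in> hom ?EM (FOb ?K b) p. iso ?EM i"
      using b i_hom by blast
  qed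
qed

end

lemma adjunction_over_descent_if_equivalence:
  assumes adj: "adjunction B C F G \<eta> \<epsilon>" and A: "pseudofunctor Delta3 \<A>" and base: "PObj \<A> 1 = C"
    and K: "equivalence B (lax_Desc \<A>) K" and G: "functor_eq B G (lax_Desc_forget \<circ>\<^sub>F K)"
  shows "adjunction_over_descent B C F G \<eta> \<epsilon> \<A> (\<lambda>b. snd (FOb K b))"
proof -
  interpret adjunction B C F G \<eta> \<epsilon> by fact
  interpret descent_diagram \<A> using A by (simp add: descent_diagram_def)
  interpret K: fully_faithful B "lax_Desc \<A>" K by (rule equivalence_imp_fully_faithful_essentially_surjective[OF K])
  interpret K: essentially_surjective B "lax_Desc \<A>" K by (rule equivalence_imp_fully_faithful_essentially_surjective[OF K])
  let ?\<phi> = "\<lambda>b. snd (FOb K b)"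
  have K_ob: "FOb K b = (FOb G b, ?\<phi> b)" if "b \<in> Obj B" for b
    using G that by (simp add: functor_eq_def functor_comp_def lax_Desc_forget_def prod_eq_iff)
  have K_fst: "fst (FOb K b) = FOb G b" if "b \<in> Obj B" for b
    using K_ob[OF that] by (metis fst_conv)
  have data_ob: "Obj (lax_Desc \<A>) = lax_descent_data \<A>"
    by (simp add: lax_Desc_def structured_category_sel)
  have K_ar: "FAr K f = ((FOb G b, ?\<phi> b), FAr G f, (FOb G b', ?\<phi> b'))"
    and K_sq: "square (PObj \<A> 2) (?\<phi> b) (FAr (PArr \<A> (\<d> 1)) (FAr G f))
      (FAr (PArr \<A> (\<d> 0)) (FAr G f)) (?\<phi> b')" if f: "f \<in> hom B b b'" for f b b'
  proof -
    note b = F.cod.hom_Obj[OF f]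
    have "FAr K f \<in> hom (lax_Desc \<A>) (FOb G b, ?\<phi> b) (FOb G b', ?\<phi> b')"
      using K.FAr_in_hom[OF f] unfolding K_ob[OF b(1), symmetric] K_ob[OF b(2), symmetric] .
    then obtain m where m: "FAr K f = ((FOb G b, ?\<phi> b), m, (FOb G b', ?\<phi> b'))"
      and sq: "square (PObj \<A> 2) (?\<phi> b) (FAr (PArr \<A> (\<d> 1)) m) (FAr (PArr \<A> (\<d> 0)) m) (?\<phi> b')"
      unfolding lax_Desc_hom by blast
    have "FAr G f = m"
      using G f m by (simp add: functor_eq_def functor_comp_def lax_Desc_forget_def hom_iff)
    then show "FAr K f = ((FOb G b, ?\<phi> b), FAr G f, (FOb G b', ?\<phi> b'))"
      "square (PObj \<A> 2) (?\<phi> b) (FAr (PArr \<A> (\<d> 1)) (FAr G f))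
        (FAr (PArr \<A> (\<d> 0)) (FAr G f)) (?\<phi> b')"
      using m sq by simp_all
  qed
  show ?thesis
  proof unfold_locales
    show "PObj \<A> 1 = C" by fact
  next
    fix b assume b: "b \<in> Obj B"
    then show "(FOb G b, ?\<phi> b) \<in> lax_descent_data \<A>"
      using K.FOb_in_Obj[OF b] unfolding K_ob[OF b, symmetric] data_ob by simp
  next
    fix f b b' assume "f \<in> hom B b b'"
    then show "square (PObj \<A> 2) (?\<phi> b) (FAr (PArr \<A> (\<d> 1)) (FAr G f))
      (FAr (PArr \<A> (\<d> 0)) (FAr G f)) (?\<phi> b')"
      by (rule K_sq)
  next
    fix b b' m assume b: "b \<in> Obj B" "b' \<in> Obj B" and m: "m \<in> hom C (FOb G b) (FOb G b')"
      and sq: "square (PObj \<A> 2) (?\<phi> b) (FAr (PArr \<A> (\<d> 1)) m) (FAr (PArr \<A> (\<d> 0)) m) (?\<phi> b')"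
    have data: "(FOb G b, ?\<phi> b) \<in> lax_descent_data \<A>" "(FOb G b', ?\<phi> b') \<in> lax_descent_data \<A>"
      using K.FOb_in_Obj b unfolding K_ob[OF b(1), symmetric] K_ob[OF b(2), symmetric] data_ob by auto
    have "((FOb G b, ?\<phi> b), m, (FOb G b', ?\<phi> b')) \<in> hom (lax_Desc \<A>) (FOb K b) (FOb K b')"
      using data m sq base
        lax_Desc_hom[of _ "FOb G b" "?\<phi> b" "FOb G b'" "?\<phi> b'",
          folded K_ob[OF b(1)] K_ob[OF b(2)]]
      unfolding K_ob[OF b(1), symmetric] K_ob[OF b(2), symmetric] by blast
    then obtain f where "f \<in> hom B b b'" "FAr K f = ((FOb G b, ?\<phi> b), m, (FOb G b', ?\<phi> b'))"
      using K.full[OF b] by blast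
    then show "\<exists>f \<in> hom B b b'. FAr G f = m"
      using K_ar by auto
  next
    fix f g b b' assume fg: "f \<in> hom B b b'" "g \<in> hom B b b'" "FAr G f = FAr G g"
    then show "f = g"
      using K_ar[OF fg(1)] K_ar[OF fg(2)] by (intro K.faithful[OF fg(1,2)]) simp
  next
    fix x \<psi> assume "(x, \<psi>) \<in> lax_descent_data \<A>"
    then obtain b h where b: "b \<in> Obj B" and h: "h \<in> hom (lax_Desc \<A>) (FOb K b) (x, \<psi>)"
      and iso: "iso (lax_Desc \<A>) h"
      using K.ess_surj[of "(x, \<psi>)"] data_ob by blast
    obtain k where hk: "inverse_arrows (lax_Desc \<A>) h k"
      using iso by (auto simp: iso_def)
    then have k: "k \<in> hom (lax_Desc \<A>) (x, \<psi>) (FOb K b)"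
      and kh: "k \<cdot>\<^bsub>lax_Desc \<A>\<^esub> h = Idt (lax_Desc \<A>) (FOb K b)"
        "h \<cdot>\<^bsub>lax_Desc \<A>\<^esub> k = Idt (lax_Desc \<A>) (x, \<psi>)"
      using K.cod.inverse_arrows_hom[OF h] by blast+
    obtain i where i: "h = (FOb K b, i, (x, \<psi>))" "i \<in> hom C (FOb G b) x"
      using h base lax_Desc_hom[of h "FOb G b" "?\<phi> b" x \<psi>, folded K_ob[OF b]] by blast
    obtain j where j: "k = ((x, \<psi>), j, FOb K b)" "j \<in> hom C x (FOb G b)"
      "square (PObj \<A> 2) \<psi> (FAr (PArr \<A> (\<d> 1)) j) (FAr (PArr \<A> (\<d> 0)) j) (?\<phi> b)"
      using k base lax_Desc_hom[of k x \<psi> "FOb G b" "?\<phi> b", folded K_ob[OF b]] by blast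
    have "inverse_arrows C i j"
      using kh K_fst[OF b] base unfolding F.dom.inverse_arrows_hom[OF i(2)]
      by (simp add: i(1) j(1,2) lax_Desc_def structured_category_sel)
    then show "\<exists>b \<in> Obj B. \<exists>i \<in> hom C (FOb G b) x. \<exists>j. inverse_arrows C i j \<and>
        square (PObj \<A> 2) \<psi> (FAr (PArr \<A> (\<d> 1)) j) (FAr (PArr \<A> (\<d> 0)) j) (?\<phi> b)"
      using b i(2) j(3) by blast
  qed
qed

theorem theorem2p7:
  fixes B :: "('ob, 'mb) category" and C :: "('o, 'm) category"
    and G :: "('ob, 'mb, 'o, 'm) fctr"
    and \<A> :: "(nat, ordmap, 'o, 'm) pseudo_data"
    and K :: "('ob, 'mb, 'o \<times> 'm, ('o \<times> 'm) \<times> 'm \<times> ('o \<times> 'm)) fctr"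
  assumes "is_functor B C G"
    and "has_left_adjoint B C G"
    and "pseudofunctor Delta3 \<A>"
    and "PObj \<A> 1 = C"
    and "equivalence B (lax_Desc \<A>) K"
    and "functor_eq B G (lax_Desc_forget \<circ>\<^sub>F K)"
  shows "monadic B C G"
proof -
  have "equivalence B (EM_of_adjunction C F G \<eta> \<epsilon>) (comparison_functor B G \<epsilon>)"
    if "adjunction B C F G \<eta> \<epsilon>" for F \<eta> \<epsilon>
    using adjunction_over_descent_if_equivalence[OF that assms(3-6)]
    by (rule adjunction_over_descent.comparison_is_equivalence)
  then show ?thesis
    using assms(2) by (simp add: monadic_def)
qed

end
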